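(* Let $QR_{20}$ denote the extended quadratic residue code of length $20$ over $\mathrm{GF}(7)$. Then $QR_{20}$ is a self-dual $[20,10,9]$ code over $\mathrm{GF}(7)$ with $A_7(QR_{20})\cong D_{20}^+$. Moreover, every self-dual $[20,10,9]$ code $C$ over $\mathrm{GF}(7)$ such that $A_7(C)\cong D_{20}^+$ is equivalent to $QR_{20}$.
   Context: An $[n,k,d]$ code over $\mathrm{GF}(p)$ is a $k$-dimensional subspace of $\mathrm{GF}(p)^n$ with minimum nonzero Hamming weight $d$. A code $C$ is self-dual if $C=C^\perp$ with respect to the standard inner product. Two codes $C,C'$ of length $n$ are equivalent if there is an $n\times n$ $(1,-1,0)$-monomial matrix $M$ (a permutation matrix with some entries replaced by $-1$) with $C'=\{cM\mid c\in C\}$. The extended quadratic residue code $QR_{20}$ is obtained by extending the quadratic residue code of prime length $19$ over $\mathrm{GF}(7)$ (note $7$ is a quadratic residue mod $19$) by one coordinate, in the standard way making it self-dual. Construction A: let $\varepsilon_1,\dots,\varepsilon_n$ be an orthogonal basis of $\mathbb{R}^n$ with $(\varepsilon_i,\varepsilon_j)=p\,\delta_{i,j}$. For a code $C$ of length $n$ over $\mathrm{GF}(p)$, $A_p(C)=\{\frac1p\sum_{i=1}^n x_i\varepsilon_i \mid x\in\mathbb{Z}^n,\ x \bmod p\in C\}$. Lattices $L,L'\subset\mathbb{R}^n$ are isomorphic ($L\cong L'$) if $L'=\{xA\mid x\in L\}$ for some orthogonal matrix $A$. With $e_1,\dots,e_{20}$ the standard basis of $\mathbb{R}^{20}$: $D_{20}=\{\sum\alpha_ie_i\mid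 \alpha\in\mathbb{Z}^{20},\ \sum\alpha_i\equiv 0\pmod 2\}$ and $D_{20}^+=\langle D_{20},\tfrac12\mathbf{1}\rangle$, where $\mathbf 1$ is the all-one vector. *)

theory Defs
  imports "HOL-Analysis.Analysis" "HOL-Library.Numeral_Type"
          "HOL-Computational_Algebra.Polynomial"
begin

text \<open>Codes of length n over GF(p) are sets of vectors of type 'a ^ 'n, where the
  index type 'n has n elements and the coefficient ring 'a is a numeral type
  (the type 7 from Numeral_Type is the ring Z/7Z = GF(7)).\<close>

definition dot :: "'a::comm_ring_1 ^ 'n \<Rightarrow> 'a ^ 'n \<Rightarrow> 'a" where
  "dot x y = (\<Sum>i\<in>UNIV. x $ i * y $ i)"

definition linear_code :: "('a::comm_ring_1 ^ 'n) set \<Rightarrow> bool" where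
  "linear_code C \<longleftrightarrow> 0 \<in> C \<and> (\<forall>x\<in>C. \<forall>y\<in>C. x + y \<in> C) \<and> (\<forall>a x. x \<in> C \<longrightarrow> a *s x \<in> C)"

definition hamming_weight :: "'a::zero ^ 'n \<Rightarrow> nat" where
  "hamming_weight x = card {i. x $ i \<noteq> 0}"

definition min_distance :: "('a::zero ^ 'n) set \<Rightarrow> nat" where
  "min_distance C = Min {hamming_weight c | c. c \<in> C \<and> c \<noteq> 0}"

text \<open>An [n,k,d] code over GF(p) (n = CARD('n), p = CARD('a)): a k-dimensional subspace,
  i.e. a subspace with p^k elements, with minimum nonzero weight d.\<close>
definition is_code :: "('a::{comm_ring_1,finite} ^ 'n) set \<Rightarrow> nat \<Rightarrow> nat \<Rightarrow> bool" where
  "is_code C k d \<longleftrightarrow> linear_code C \<and> card C = CARD('a) ^ k \<and> min_distance C = d"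

definition dual_code :: "('a::comm_ring_1 ^ 'n) set \<Rightarrow> ('a ^ 'n) set" where
  "dual_code C = {y. \<forall>x\<in>C. dot x y = 0}"

definition self_dual :: "('a::comm_ring_1 ^ 'n) set \<Rightarrow> bool" where
  "self_dual C \<longleftrightarrow> C = dual_code C"

definition signed_perm_matrix :: "'a::comm_ring_1 ^ 'n ^ 'n \<Rightarrow> bool" where
  "signed_perm_matrix M \<longleftrightarrow>
     (\<exists>\<sigma> s. \<sigma> permutes (UNIV :: 'n set) \<and> (\<forall>i. s i = 1 \<or> s i = -1) \<and>
            M = (\<chi> i j. if j = \<sigma> i then s i else 0))"

definition code_equiv :: "('a::comm_ring_1 ^ 'n) set \<Rightarrow> ('a ^ 'n) set \<Rightarrow> bool" where
  "code_equiv C C' \<longleftrightarrow> (\<exists>M. signed_perm_matrix M \<and> C' = (\<lambda>c. c v* M) ` C)"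

text \<open>Construction A with the orthogonal basis eps_i = sqrt p * e_i (so (eps_i,eps_j) = p delta_ij):
  A_p(C) = { (1/p) sum x_i eps_i | x in Z^n, x mod p in C }.\<close>
definition constructionA :: "nat \<Rightarrow> ('a::comm_ring_1 ^ 'n) set \<Rightarrow> (real ^ 'n) set" where
  "constructionA p C =
     {(1 / real p) *\<^sub>R (\<chi> i. sqrt (real p) * real_of_int (x $ i)) | x :: int ^ 'n.
        (\<chi> i. (of_int (x $ i) :: 'a)) \<in> C}"

definition lattice_iso :: "(real ^ 'n) set \<Rightarrow> (real ^ 'n) set \<Rightarrow> bool" where
  "lattice_iso L L' \<longleftrightarrow> (\<exists>A :: real ^ 'n ^ 'n. orthogonal_matrix A \<and> L' = (\<lambda>x. x v* A) ` L)"

definition D_lattice :: "(real ^ 'n) set" where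
  "D_lattice = {(\<chi> i. real_of_int (a $ i)) | a :: int ^ 'n. even (\<Sum>i\<in>UNIV. a $ i)}"

definition D_plus_lattice :: "(real ^ 'n) set" where
  "D_plus_lattice = {v + real_of_int k *\<^sub>R (\<chi> i. 1 / 2) | v k. v \<in> D_lattice}"

text \<open>Quadratic residue code of length 19 over GF(7): the cyclic code (ideal of
  GF(7)[x]/(x^19-1), represented by polynomials of degree < 19) generated by
  g(x) = prod_{r in Q} (x - alpha^r), Q = {1,4,5,6,7,9,11,16,17} the quadratic residues mod 19,
  alpha a primitive 19th root of unity in GF(7^3).  Computing this product gives
  g(x) = 6 + x + 2x^2 + 4x^3 + 6x^4 + 4x^5 + 5x^7 + 2x^8 + x^9.\<close>
definition qr19_gen :: "7 poly" where
  "qr19_gen = [:6, 1, 2, 4, 6, 4, 0, 5, 2, 1:]"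

definition QR19 :: "7 poly set" where
  "QR19 = {c. degree c < 19 \<and> qr19_gen dvd c}"

text \<open>Extension by one coordinate c_inf = 2 * sum c_i (2^2 * 19 + 1 = 0 in GF(7)), which makes
  the extended code self-dual.  Coordinates 0..18 are indexed by of_nat j, c_inf by of_nat 19.\<close>
definition qr_extend :: "7 poly \<Rightarrow> 7 ^ 20" where
  "qr_extend c = (\<Sum>j<20. axis (of_nat j :: 20)
                     (if j < 19 then coeff c j else 2 * (\<Sum>k<19. coeff c k)))"

definition QR20 :: "(7 ^ 20) set" where
  "QR20 = qr_extend ` QR19"

end

theory Submission
  imports Defs "HOL-Combinatorics.Permutations"
begin

text \<open>If \<open>A\<^sub>7(C)\<close> is isomorphic to \<open>D\<^sub>2\<^sub>0\<^sup>+\<close>, then \<open>D\<^sub>2\<^sub>0\<^sup>+\<close> contains 20 orthogonal vectors of norm 7. As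
  \<open>D\<^sub>2\<^sub>0\<close> is even, these have the shape \<open>(\<plusminus>1/2, \<dots>, \<plusminus>1/2, \<plusminus>3/2)\<close>; after a signed permutation they form the
  matrix \<open>R/2\<close>, where \<open>R\<close> has diagonal entries 3, off-diagonal entries \<open>\<plusminus>1\<close> and \<open>R R\<^sup>T = 28 I\<close>, and the rows of
  \<open>R\<close> are codewords modulo 7. Minimum weight 9 forces \<open>R - 3 I\<close> to be skew, so that \<open>R - 2 I\<close> is a
  skew-Hadamard matrix. Such matrices are classified by choosing their rows one at a time: the
  state is the multiset of columns of the rows chosen so far, orthogonality leaves few ways to
  split the column classes by a new row, and combinations of at most four rows with weight below 9
  kill all branches except those in which the ten chosen rows agree, up to a permutation of the
  columns, with ten rows of the Paley matrix that span \<open>QR20\<close>.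

  The minimum weight of \<open>QR20\<close> itself is found from two systematic generator matrices with
  complementary information sets: a word of weight at most 8 has weight at most 4 on one of them.\<close>

section \<open>Vectors over the field with seven elements\<close>

text \<open>Two special vectors link lattice and code. Let A be the isometry and z = 2 sqrt 7 A. The
  vector sqrt 7 e_i of \<open>constructionA\<close> comes from the zero word, so row i of z is twice
  a vector of norm 7 in D_20^+. Conversely 2 e_j lies in D_20^+, and its preimage shows that column
  j of z is a codeword modulo 7. Frame vectors are thus rows of z and codewords its columns, and R
  is assembled from the columns. For \<open>QR20\<close> itself the isometry is the transposed Paley
  matrix over 2 sqrt 7; it works because the rows lie in the code, all entries are odd and all
  column sums are divisible by 4. The search stays small because skewness dictates a new row on the
  chosen vertices, and because the weight of a combination depends only on the multiset of columns.
  It may stop at ten rows: they span a code of dimension 10, so inclusion plus equal cardinality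
  identifies the codes and the other rows never have to be determined. All finite facts are stated
  for integer lists, with coefficients supplied as certificates.\<close>

definition ix :: "20 \<Rightarrow> nat" where
  "ix i = nat (Rep_bit0 i)"

lemma ix_less [simp]: "ix i < 20"
  using bit0.Rep_less_n[of i] by (simp add: ix_def)

lemma of_nat_ix [simp]: "of_nat (ix i) = i"
proof -
  have "0 \<le> Rep_bit0 i" using Rep_bit0[of i] by simp
  then show ?thesis
    by (simp add: ix_def bit0.of_nat_eq Rep_bit0_inverse bit0.Rep_mod del: card_bit0)
qed

lemma ix_of_nat [simp]: "j < 20 \<Longrightarrow> ix (of_nat j) = j"
  by (simp add: ix_def bit0.of_nat_eq bit0.Abs_inverse)

lemma bij_of_nat20: "bij_betw (of_nat :: nat \<Rightarrow> 20) {..<20} UNIV"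
  by (rule bij_betw_byWitness[where f' = ix]) auto

lemma sum_20: "(\<Sum>i\<in>UNIV. f (i :: 20)) = (\<Sum>j<20. f (of_nat j))"
  by (rule sum.reindex_bij_betw[OF bij_of_nat20, symmetric])

lemma of_int_7_eq_0_iff: "(of_int x :: 7) = 0 \<longleftrightarrow> 7 dvd x"
proof -
  have "(of_int x :: 7) = 0 \<longleftrightarrow> Abs_bit1 (x mod 7) = (Abs_bit1 0 :: 7)"
    by (simp add: bit1.of_int_eq zero_bit1_def)
  also have "\<dots> \<longleftrightarrow> x mod 7 = 0"
    by (subst Abs_bit1_inject) auto
  finally show ?thesis by (simp add: dvd_eq_mod_eq_0)
qed

lemma of_int_7_eq_iff: "(of_int x :: 7) = of_int y \<longleftrightarrow> x mod 7 = y mod 7"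
  using of_int_7_eq_0_iff[of "x - y"] by (simp add: mod_eq_dvd_iff)

text \<open>Lists can be evaluated, and their entries are not reduced: the same list serves as an
  integral row with entries -1, 1, 3 and as a word modulo 7.\<close>

definition gf_vec :: "int list \<Rightarrow> 7 ^ 20" where
  "gf_vec xs = (\<chi> i. of_int (xs ! ix i))"

lemma gf_vec_nth [simp]: "gf_vec xs $ i = of_int (xs ! ix i)"
  by (simp add: gf_vec_def)

lemma gf_vec_cong_mod:
  assumes "map (\<lambda>x. x mod 7) xs = map (\<lambda>x. x mod 7) ys" "length xs = 20"
  shows "gf_vec xs = gf_vec ys"
proof -
  have "length ys = 20" using assms by (metis length_map)
  then have "xs ! j mod 7 = ys ! j mod 7" if "j < 20" for j
    using assms that by (metis nth_map)
  then show ?thesis by (simp add: vec_eq_iff of_int_7_eq_iff)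
qed

lemma hamming_weight_vec:
  assumes "length xs = 20"
  shows "hamming_weight (gf_vec xs) = length (filter (\<lambda>x. x mod 7 \<noteq> 0) xs)"
proof -
  have "{i. gf_vec xs $ i \<noteq> 0} = of_nat ` {j. j < 20 \<and> xs ! j mod 7 \<noteq> 0}"
  proof (intro equalityI subsetI)
    fix i :: 20 assume "i \<in> {i. gf_vec xs $ i \<noteq> 0}"
    then show "i \<in> of_nat ` {j. j < 20 \<and> xs ! j mod 7 \<noteq> 0}"
      by (intro image_eqI[of _ _ "ix i"]) (simp_all add: of_int_7_eq_0_iff dvd_eq_mod_eq_0)
  qed (auto simp: of_int_7_eq_0_iff dvd_eq_mod_eq_0)
  moreover have "inj_on (of_nat :: nat \<Rightarrow> 20) {j. j < 20 \<and> xs ! j mod 7 \<noteq> 0}"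
    using bij_of_nat20 by (auto simp: bij_betw_def intro: inj_on_subset)
  ultimately show ?thesis
    using assms by (simp add: hamming_weight_def card_image length_filter_conv_card)
qed

section \<open>Inner products and certified linear combinations\<close>

lemma dot_comm: "dot x y = dot y x"
  by (simp add: dot_def mult.commute)

lemma dot_add_left: "dot (x + y) z = dot x z + dot y z"
  by (simp add: dot_def sum.distrib distrib_right)

lemma dot_scale_left: "dot (a *s x) z = a * dot x z"
  by (simp add: dot_def sum_distrib_left mult.assoc)

lemma dot_sum_left: "dot (\<Sum>s\<in>A. f s) z = (\<Sum>s\<in>A. dot (f s) z)"
proof -
  have "dot 0 z = 0" by (simp add: dot_def)
  then show ?thesis
    by (induction A rule: infinite_finite_induct) (simp_all add: dot_add_left)
qed

lemma dot_add_right: "dot z (x + y) = dot z x + dot z y"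
  by (simp add: dot_def sum.distrib distrib_left)

lemma dot_scale_right: "dot z (a *s x) = a * dot z x"
  by (simp add: dot_def sum_distrib_left mult.left_commute)

lemma linear_code_dual: "linear_code (dual_code C)"
  unfolding linear_code_def dual_code_def
  by (simp add: dot_add_right dot_scale_right) (simp add: dot_def)

lemma linear_code_sum:
  assumes "linear_code C" "\<And>s. s \<in> A \<Longrightarrow> f s \<in> C"
  shows "(\<Sum>s\<in>A. a s *s f s) \<in> C"
  using assms(2)
  by (induction A rule: infinite_finite_induct) (use assms(1) in \<open>auto simp: linear_code_def\<close>)

lemma linear_code_diff:
  assumes "linear_code C" "x \<in> C" "y \<in> C"
  shows "x - y \<in> C"
proof -
  have "x + (- 1) *s y \<in> C" using assms unfolding linear_code_def by blast
  then show ?thesis by (simp add: vector_sneg_minus1[symmetric])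
qed

text \<open>Surplus coefficients or rows are ignored, so any two lists denote a combination.\<close>

fun lin :: "int list \<Rightarrow> int list list \<Rightarrow> int list" where
  "lin (c # cs) (r # rs) = map2 (\<lambda>x y. c * x + y) r (lin cs rs)"
| "lin _ _ = replicate 20 0"

lemma lin_mem:
  assumes C: "linear_code C" and rs: "\<forall>r\<in>set rs. length r = 20 \<and> gf_vec r \<in> C"
  shows "length (lin cs rs) = 20 \<and> gf_vec (lin cs rs) \<in> C"
  using rs
proof (induction cs rs rule: lin.induct)
  case (1 c cs r rs)
  then have *: "length r = 20" "gf_vec r \<in> C" "length (lin cs rs) = 20" "gf_vec (lin cs rs) \<in> C"
    by auto
  then have "gf_vec (lin (c # cs) (r # rs)) = of_int c *s gf_vec r + gf_vec (lin cs rs)"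
    by (simp add: vec_eq_iff)
  then show ?case using * C by (simp add: linear_code_def)
next
  case ("2_1" uv)
  have "gf_vec (replicate 20 0) = 0" by (simp add: vec_eq_iff)
  then show ?case using C by (simp add: linear_code_def)
next
  case ("2_2" uu)
  have "gf_vec (replicate 20 0) = 0" by (simp add: vec_eq_iff)
  then show ?case using C by (simp add: linear_code_def)
qed

text \<open>The matrix \<open>cs\<close> is a certificate: checking it is one matrix product modulo
  7, without elimination.\<close>

definition spans :: "int list list \<Rightarrow> int list list \<Rightarrow> int list list \<Rightarrow> bool" where
  "spans cs rs ts \<longleftrightarrow>
     list_all2 (\<lambda>c t. map (\<lambda>x. x mod 7) (lin c rs) = map (\<lambda>x. x mod 7) t) cs ts"

lemma spans_mem:
  assumes "spans cs rs ts" "linear_code C" "\<forall>r\<in>set rs. length r = 20 \<and> gf_vec r \<in> C" "t \<in> set ts"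
  shows "gf_vec t \<in> C"
proof -
  obtain c where "map (\<lambda>x. x mod 7) (lin c rs) = map (\<lambda>x. x mod 7) t"
    using assms(1,4) by (auto simp: spans_def list_all2_conv_all_nth in_set_conv_nth)
  then show ?thesis
    using lin_mem[OF assms(2,3), of c] gf_vec_cong_mod by metis
qed

definition ldot :: "int list \<Rightarrow> int list \<Rightarrow> int" where
  "ldot xs ys = sum_list (map2 (*) xs ys)"

lemma dot_vec:
  assumes "length xs = 20" "length ys = 20"
  shows "dot (gf_vec xs) (gf_vec ys) = of_int (ldot xs ys)"
proof -
  have "dot (gf_vec xs) (gf_vec ys) = of_int (\<Sum>j<20. xs ! j * ys ! j)"
    by (simp add: dot_def sum_20)
  also have "(\<Sum>j<20. xs ! j * ys ! j) = ldot xs ys"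
    using assms by (simp add: ldot_def sum_list_sum_nth atLeast0LessThan)
  finally show ?thesis .
qed

section \<open>The code \<open>QR20\<close>\<close>

definition gen_coeffs :: "int list" where
  "gen_coeffs = [6, 1, 2, 4, 6, 4, 0, 5, 2, 1]"

definition qr_gens :: "int list list" where
  "qr_gens = map (\<lambda>s. let c = replicate s 0 @ gen_coeffs @ replicate (9 - s) 0
                      in c @ [2 * sum_list c]) [0..<10]"

definition unit_vec :: "nat \<Rightarrow> int list" where
  "unit_vec s = (replicate 10 0)[s := 1]"

text \<open>The systematic bases are (I | \<open>right_block\<close>) and (\<open>left_block\<close>
  | I). Hence the two blocks are inverse to each other modulo 7, and by self-orthogonality
  \<open>left_block\<close> is also minus the transpose of \<open>right_block\<close>.\<close>

definition left_block :: "int list list" where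
  "left_block =
  [[1, 5, 6, 5, 5, 2, 4, 2, 3, 1],
   [6, 3, 6, 1, 0, 3, 5, 2, 6, 2],
   [5, 3, 5, 3, 5, 3, 2, 1, 3, 4],
   [3, 6, 0, 6, 4, 4, 1, 1, 3, 6],
   [1, 1, 5, 5, 4, 6, 1, 3, 4, 4],
   [3, 2, 5, 6, 6, 3, 4, 0, 5, 0],
   [0, 3, 2, 5, 6, 6, 3, 4, 0, 5],
   [2, 3, 1, 5, 1, 3, 0, 0, 3, 2],
   [5, 6, 5, 5, 2, 4, 2, 3, 1, 1],
   [1, 6, 5, 3, 1, 3, 0, 2, 5, 6]]"

definition right_block :: "int list list" where
  "right_block =
  [[6, 1, 2, 4, 6, 4, 0, 5, 2, 6],
   [2, 4, 4, 1, 6, 5, 4, 4, 1, 1],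
   [1, 1, 2, 0, 2, 2, 5, 6, 2, 2],
   [2, 6, 4, 1, 2, 1, 2, 2, 2, 4],
   [2, 0, 2, 3, 3, 1, 1, 6, 5, 6],
   [5, 4, 4, 3, 1, 4, 1, 4, 3, 4],
   [3, 2, 5, 6, 6, 3, 4, 0, 5, 0],
   [5, 5, 6, 6, 4, 0, 3, 0, 4, 5],
   [4, 1, 4, 4, 3, 2, 0, 4, 6, 2],
   [6, 5, 3, 1, 3, 0, 2, 5, 6, 1]]"

definition left_basis :: "int list list" where
  "left_basis = map2 (\<lambda>s r. unit_vec s @ r) [0..<10] right_block"

definition right_basis :: "int list list" where
  "right_basis = map2 (\<lambda>s r. r @ unit_vec s) [0..<10] left_block"

text \<open>Row \<open>i\<close> is \<open>3 e\<^sub>i + (\<chi>(j - i))\<^sub>j\<close> with the Legendre symbol \<open>\<chi>\<close> modulo 19,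
  bordered by \<open>-1\<close> in column 19 and \<open>1\<close> in row 19.\<close>
definition paley :: "int list list" where
  "paley =
  [[3, 1, -1, -1, 1, 1, 1, 1, -1, 1, -1, 1, -1, -1, -1, -1, 1, 1, -1, -1],
   [-1, 3, 1, -1, -1, 1, 1, 1, 1, -1, 1, -1, 1, -1, -1, -1, -1, 1, 1, -1],
   [1, -1, 3, 1, -1, -1, 1, 1, 1, 1, -1, 1, -1, 1, -1, -1, -1, -1, 1, -1],
   [1, 1, -1, 3, 1, -1, -1, 1, 1, 1, 1, -1, 1, -1, 1, -1, -1, -1, -1, -1],
   [-1, 1, 1, -1, 3, 1, -1, -1, 1, 1, 1, 1, -1, 1, -1, 1, -1, -1, -1, -1],
   [-1, -1, 1, 1, -1, 3, 1, -1, -1, 1, 1, 1, 1, -1, 1, -1, 1, -1, -1, -1],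
   [-1, -1, -1, 1, 1, -1, 3, 1, -1, -1, 1, 1, 1, 1, -1, 1, -1, 1, -1, -1],
   [-1, -1, -1, -1, 1, 1, -1, 3, 1, -1, -1, 1, 1, 1, 1, -1, 1, -1, 1, -1],
   [1, -1, -1, -1, -1, 1, 1, -1, 3, 1, -1, -1, 1, 1, 1, 1, -1, 1, -1, -1],
   [-1, 1, -1, -1, -1, -1, 1, 1, -1, 3, 1, -1, -1, 1, 1, 1, 1, -1, 1, -1],
   [1, -1, 1, -1, -1, -1, -1, 1, 1, -1, 3, 1, -1, -1, 1, 1, 1, 1, -1, -1],
   [-1, 1, -1, 1, -1, -1, -1, -1, 1, 1, -1, 3, 1, -1, -1, 1, 1, 1, 1, -1],
   [1, -1, 1, -1, 1, -1, -1, -1, -1, 1, 1, -1, 3, 1, -1, -1, 1, 1, 1, -1],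
   [1, 1, -1, 1, -1, 1, -1, -1, -1, -1, 1, 1, -1, 3, 1, -1, -1, 1, 1, -1],
   [1, 1, 1, -1, 1, -1, 1, -1, -1, -1, -1, 1, 1, -1, 3, 1, -1, -1, 1, -1],
   [1, 1, 1, 1, -1, 1, -1, 1, -1, -1, -1, -1, 1, 1, -1, 3, 1, -1, -1, -1],
   [-1, 1, 1, 1, 1, -1, 1, -1, 1, -1, -1, -1, -1, 1, 1, -1, 3, 1, -1, -1],
   [-1, -1, 1, 1, 1, 1, -1, 1, -1, 1, -1, -1, -1, -1, 1, 1, -1, 3, 1, -1],
   [1, -1, -1, 1, 1, 1, 1, -1, 1, -1, 1, -1, -1, -1, -1, 1, 1, -1, 3, -1],
   [1, 1, 1, 1, 1, 1, 1, 1, 1, 1, 1, 1, 1, 1, 1, 1, 1, 1, 1, 3]]"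

text \<open>The first ten coordinates of \<open>qr_gens\<close> form the triangular Toeplitz matrix
  of the generator g. Its inverse is the Toeplitz matrix of the power series 1/g modulo x^10, whose
  coefficients make up the first row.\<close>

definition left_coeffs :: "int list list" where
  "left_coeffs =
  [[6, 6, 4, 5, 3, 5, 2, 2, 1, 2],
   [0, 6, 6, 4, 5, 3, 5, 2, 2, 1],
   [0, 0, 6, 6, 4, 5, 3, 5, 2, 2],
   [0, 0, 0, 6, 6, 4, 5, 3, 5, 2],
   [0, 0, 0, 0, 6, 6, 4, 5, 3, 5],
   [0, 0, 0, 0, 0, 6, 6, 4, 5, 3],
   [0, 0, 0, 0, 0, 0, 6, 6, 4, 5],
   [0, 0, 0, 0, 0, 0, 0, 6, 6, 4],
   [0, 0, 0, 0, 0, 0, 0, 0, 6, 6],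
   [0, 0, 0, 0, 0, 0, 0, 0, 0, 6]]"

lemma lengths_20:
  "\<forall>r\<in>set qr_gens. length r = 20" "\<forall>r\<in>set left_basis. length r = 20"
  "\<forall>r\<in>set right_basis. length r = 20" "\<forall>r\<in>set paley. length r = 20"
  "length qr_gens = 10" "length left_basis = 10" "length right_basis = 10" "length paley = 20"
  by code_simp+

lemma spans_left_basis: "spans left_coeffs qr_gens left_basis" by code_simp
text \<open>As \<open>left_basis\<close> is the identity on the first ten coordinates, a word is the
  combination whose coefficients are its own first ten entries.\<close>

lemma spans_right_basis: "spans (map (take 10) right_basis) left_basis right_basis" by code_simp
lemma spans_paley: "spans (map (take 10) paley) left_basis paley" by code_simp

lemma qr_gens_orthogonal: "\<forall>x\<in>set qr_gens. \<forall>y\<in>set qr_gens. ldot x y mod 7 = 0"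
  by code_simp

section \<open>From multiples of the generator polynomial to ten list generators\<close>

lemma qr_extend_nth:
  "qr_extend c $ i = (if ix i < 19 then coeff c (ix i) else 2 * (\<Sum>k<19. coeff c k))"
proof -
  have "qr_extend c $ i = (\<Sum>j<20. if j = ix i then (if j < 19 then coeff c j else 2 * (\<Sum>k<19. coeff c k)) else 0)"
    unfolding qr_extend_def sum_component
  proof (rule sum.cong)
    fix j :: nat assume "j \<in> {..<20}"
    then have "of_nat j = i \<longleftrightarrow> j = ix i" by auto
    then show "axis (of_nat j) (if j < 19 then coeff c j else 2 * (\<Sum>k<19. coeff c k)) $ i =
        (if j = ix i then (if j < 19 then coeff c j else 2 * (\<Sum>k<19. coeff c k)) else 0)"
      by (auto simp: axis_def)
  qed simp
  then show ?thesis by simp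
qed

lemma qr_extend_add: "qr_extend (c + d) = qr_extend c + qr_extend d"
  by (simp add: vec_eq_iff qr_extend_nth sum.distrib distrib_left)

lemma qr_extend_smult: "qr_extend (smult a c) = a *s qr_extend c"
  by (simp add: vec_eq_iff qr_extend_nth sum_distrib_left mult.left_commute)

lemma qr_extend_sum: "qr_extend (\<Sum>s\<in>A. smult (a s) (f s)) = (\<Sum>s\<in>A. a s *s qr_extend (f s))"
proof -
  have "qr_extend 0 = 0" by (simp add: vec_eq_iff qr_extend_nth)
  then show ?thesis
    by (induction A rule: infinite_finite_induct) (simp_all add: qr_extend_add qr_extend_smult)
qed

lemma coeff_qr19_gen: "coeff qr19_gen j = (if j < 10 then of_int (gen_coeffs ! j) else 0)"
proof -
  have g: "qr19_gen = Poly (map of_int gen_coeffs)"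
    by (simp add: qr19_gen_def gen_coeffs_def)
  have "coeff qr19_gen j = nth_default 0 (map of_int gen_coeffs) j"
    unfolding g by (simp only: coeff_Poly_eq)
  moreover have "length gen_coeffs = 10" by (simp add: gen_coeffs_def)
  ultimately show ?thesis by (simp add: nth_default_def)
qed

lemma qr19_gen_props: "degree qr19_gen = 9" "lead_coeff qr19_gen = 1"
  by (simp_all add: qr19_gen_def)

text \<open>For s < 10 the product x^s g has degree below 19, so the cyclic shift is mere padding by
  zeros, without wrap-around.\<close>

lemma qr_extend_shift:
  assumes "s < 10"
  shows "qr_extend (monom 1 s * qr19_gen) = gf_vec (qr_gens ! s)"
proof -
  define c where "c = replicate s 0 @ gen_coeffs @ replicate (9 - s) 0"
  have len: "length gen_coeffs = 10" by (simp add: gen_coeffs_def)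
  have lc: "length c = 19" using assms by (simp add: c_def len)
  have g: "qr_gens ! s = c @ [2 * sum_list c]"
    using assms by (simp add: qr_gens_def Let_def c_def del: upt_Suc upt_rec_numeral)
  have co: "coeff (monom 1 s * qr19_gen) j = of_int (c ! j)" if "j < 19" for j
    using that assms by (auto simp: coeff_monom_mult coeff_qr19_gen c_def nth_append len)
  have "sum_list c = (\<Sum>k<19. c ! k)"
    by (simp add: sum_list_sum_nth lc atLeast0LessThan)
  then have su: "of_int (sum_list c) = (\<Sum>k<19. coeff (monom 1 s * qr19_gen) k)"
    by (simp add: co)
  show ?thesis
  proof (rule iffD2[OF vec_eq_iff], rule allI)
    fix i :: 20
    show "qr_extend (monom 1 s * qr19_gen) $ i = gf_vec (qr_gens ! s) $ i"
    proof (cases "ix i < 19")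
      case True
      then show ?thesis by (simp add: qr_extend_nth g nth_append lc co)
    next
      case False
      then have "ix i = 19" using ix_less[of i] by linarith
      then show ?thesis by (simp add: qr_extend_nth g nth_append lc su)
    qed
  qed
qed

lemma linear_QR20: "linear_code QR20"
  unfolding linear_code_def
proof (intro conjI ballI allI impI)
  have "qr_extend 0 \<in> QR20" by (auto simp: QR20_def QR19_def)
  moreover have "qr_extend 0 = 0" by (simp add: vec_eq_iff qr_extend_nth)
  ultimately show "0 \<in> QR20" by simp
next
  fix x y assume "x \<in> QR20" "y \<in> QR20"
  then show "x + y \<in> QR20"
    by (auto simp: QR20_def QR19_def qr_extend_add[symmetric] intro!: imageI degree_add_less)
next
  fix a x assume "x \<in> QR20"
  then show "a *s x \<in> QR20"
    by (auto simp: QR20_def QR19_def qr_extend_smult[symmetric] dvd_smult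
        intro!: imageI le_less_trans[OF degree_smult_le])
qed

lemma gf_vec_qr_gens: "r \<in> set qr_gens \<Longrightarrow> gf_vec r \<in> QR20"
proof -
  assume "r \<in> set qr_gens"
  then obtain s where s: "s < 10" "r = qr_gens ! s"
    by (auto simp: in_set_conv_nth lengths_20)
  have "degree (monom 1 s * qr19_gen) \<le> degree (monom (1::7) s) + degree qr19_gen"
    by (rule degree_mult_le)
  also have "\<dots> < 19" using s degree_monom_le[of "1::7" s] by (simp add: qr19_gen_props)
  finally have "monom 1 s * qr19_gen \<in> QR19" by (simp add: QR19_def)
  then show ?thesis using qr_extend_shift[OF s(1)] s(2) by (metis QR20_def imageI)
qed

text \<open>The generator is monic of degree 9, so the quotient of a multiple of degree below 19 has
  degree at most 9; the coefficients of the quotient are the coefficients of the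
  combination.\<close>

lemma QR20_gens:
  assumes "v \<in> QR20"
  obtains a where "v = (\<Sum>s<10. a s *s gf_vec (qr_gens ! s))"
proof -
  obtain c where c: "degree c < 19" "qr19_gen dvd c" "v = qr_extend c"
    using assms by (auto simp: QR20_def QR19_def)
  obtain q where q: "c = qr19_gen * q" using c(2) by (rule dvdE)
  have "degree q < 10"
  proof (cases "q = 0")
    case False
    have "coeff (qr19_gen * q) (degree qr19_gen + degree q) = lead_coeff q"
      by (simp only: coeff_mult_degree_sum qr19_gen_props(2) mult_1)
    with False have "coeff (qr19_gen * q) (degree qr19_gen + degree q) \<noteq> 0"
      by simp
    then show ?thesis using c(1) q le_degree by (fastforce simp: qr19_gen_props)
  qed simp
  then have "q = (\<Sum>s<10. monom (coeff q s) s)"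
    using poly_as_sum_of_monoms'[of q 9] by (simp add: lessThan_Suc_atMost[symmetric])
  then have "c = (\<Sum>s<10. monom (coeff q s) s) * qr19_gen"
    using q by (simp add: mult.commute)
  also have "\<dots> = (\<Sum>s<10. smult (coeff q s) (monom 1 s * qr19_gen))"
    by (simp add: sum_distrib_right smult_monom mult_smult_left[symmetric] del: mult_smult_left)
  finally have "v = (\<Sum>s<10. coeff q s *s qr_extend (monom 1 s * qr19_gen))"
    using c(3) by (simp add: qr_extend_sum)
  also have "\<dots> = (\<Sum>s<10. coeff q s *s gf_vec (qr_gens ! s))"
    by (intro sum.cong) (simp_all add: qr_extend_shift)
  finally show thesis by (rule that)
qed

lemma QR20_self_orthogonal: "QR20 \<subseteq> dual_code QR20"
proof
  fix y assume "y \<in> QR20"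
  then obtain b where b: "y = (\<Sum>s<10. b s *s gf_vec (qr_gens ! s))" using QR20_gens by blast
  have "dot x y = 0" if x: "x \<in> QR20" for x
  proof -
    obtain a where a: "x = (\<Sum>s<10. a s *s gf_vec (qr_gens ! s))" using QR20_gens[OF x] by blast
    have o: "dot (gf_vec (qr_gens ! s)) (gf_vec (qr_gens ! t)) = 0" if "s < 10" "t < 10" for s t
      using that qr_gens_orthogonal
      by (subst dot_vec) (auto simp: lengths_20 of_int_7_eq_0_iff dvd_eq_mod_eq_0)
    have "dot (gf_vec (qr_gens ! s)) y = 0" if "s < 10" for s
      unfolding b using that
      by (subst dot_comm) (simp add: dot_sum_left dot_scale_left o)
    then show ?thesis unfolding a by (simp add: dot_sum_left dot_scale_left)
  qed
  then show "y \<in> dual_code QR20" by (simp add: dual_code_def)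
qed

lemma gf_vec_basis:
  "r \<in> set left_basis \<Longrightarrow> gf_vec r \<in> QR20"
  "r \<in> set right_basis \<Longrightarrow> gf_vec r \<in> QR20"
  "r \<in> set paley \<Longrightarrow> gf_vec r \<in> QR20"
proof -
  have *: "\<forall>r\<in>set left_basis. length r = 20 \<and> gf_vec r \<in> QR20"
    using spans_mem[OF spans_left_basis linear_QR20] by (auto simp: lengths_20 gf_vec_qr_gens)
  then show "r \<in> set left_basis \<Longrightarrow> gf_vec r \<in> QR20" by blast
  show "r \<in> set right_basis \<Longrightarrow> gf_vec r \<in> QR20"
    using spans_mem[OF spans_right_basis linear_QR20 *] .
  show "r \<in> set paley \<Longrightarrow> gf_vec r \<in> QR20"
    using spans_mem[OF spans_paley linear_QR20 *] .
qed

section \<open>Information sets, self-duality and cardinality\<close>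

lemma basis_nth:
  assumes "s < 10" "t < 10"
  shows "left_basis ! s ! t = (if s = t then 1 else 0)"
    "left_basis ! s ! (10 + t) = right_block ! s ! t"
    "right_basis ! s ! (10 + t) = (if s = t then 1 else 0)"
    "right_basis ! s ! t = left_block ! s ! t"
proof -
  have l: "length left_block = 10" "length right_block = 10"
    "\<forall>r\<in>set left_block. length r = 10" by code_simp+
  have ls: "length (left_block ! s) = 10" using l assms by simp
  show "left_basis ! s ! t = (if s = t then 1 else 0)"
    "left_basis ! s ! (10 + t) = right_block ! s ! t"
    "right_basis ! s ! (10 + t) = (if s = t then 1 else 0)"
    "right_basis ! s ! t = left_block ! s ! t"
    using assms l ls
    by (auto simp: left_basis_def right_basis_def nth_append unit_vec_def nth_list_update
        simp del: upt_Suc upt_rec_numeral)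
qed

lemma sum_split_20: "(\<Sum>j<20. f j) = (\<Sum>j<10. f j) + (\<Sum>j<10. f (10 + j :: nat))"
  for f :: "nat \<Rightarrow> 'a::comm_monoid_add"
proof -
  have "(\<Sum>j<20. f j) = (\<Sum>j<10. f j) + (\<Sum>j=10..<20. f j)"
    using sum.atLeastLessThan_concat[of 0 10 20 f] by (simp add: atLeast0LessThan)
  also have "(\<Sum>j=10..<20. f j) = (\<Sum>j<10. f (10 + j))"
    using sum.shift_bounds_nat_ivl[of f 0 10 10] by (simp add: atLeast0LessThan add.commute)
  finally show ?thesis .
qed

text \<open>Both halves of the coordinates are information sets: a vector orthogonal to both systematic
  bases and vanishing on one half also vanishes on the other one.\<close>
lemma dual_QR20_expand:
  assumes "y \<in> dual_code QR20"
  shows "y = (\<Sum>s<10. y $ of_nat s *s gf_vec (left_basis ! s))" (is "y = ?l")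
    and "y = (\<Sum>s<10. y $ of_nat (10 + s) *s gf_vec (right_basis ! s))" (is "y = ?r")
proof -
  have mem: "gf_vec (left_basis ! s) \<in> QR20" "gf_vec (right_basis ! s) \<in> QR20" if "s < 10" for s
    using that by (simp_all add: gf_vec_basis lengths_20)
  have lin: "?l \<in> dual_code QR20" "?r \<in> dual_code QR20"
    using mem QR20_self_orthogonal by (auto intro!: linear_code_sum linear_code_dual)
  define d e where "d = y - ?l" and "e = y - ?r"
  have de: "d \<in> dual_code QR20" "e \<in> dual_code QR20"
    using lin assms by (simp_all add: d_def e_def linear_code_diff linear_code_dual)
  have d0: "d $ of_nat t = 0" if "t < 10" for t
    using that by (simp add: d_def basis_nth if_distrib[of of_int] if_distrib[of "(*) _"] cong: if_cong)
  have e0: "e $ of_nat (10 + t) = 0" if "t < 10" for t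
    using that ix_of_nat[of "10 + t"]
    by (simp add: e_def basis_nth if_distrib[of of_int] if_distrib[of "(*) _"] del: of_nat_add cong: if_cong)
  have d1: "d $ of_nat (10 + s) = 0" if "s < 10" for s
  proof -
    have "0 = dot (gf_vec (right_basis ! s)) d" using de mem that by (auto simp: dual_code_def)
    also have "\<dots> = (\<Sum>j<10. of_int (right_basis ! s ! (10 + j)) * d $ of_nat (10 + j))"
      by (simp add: dot_def sum_20 sum_split_20 d0 ix_of_nat del: of_nat_add)
    also have "\<dots> = d $ of_nat (10 + s)"
      using that by (simp add: basis_nth if_distrib[of of_int] if_distrib[of "\<lambda>x. x * _"] del: of_nat_add cong: if_cong)
    finally show ?thesis by simp
  qed
  have e1: "e $ of_nat s = 0" if "s < 10" for s
  proof -
    have "0 = dot (gf_vec (left_basis ! s)) e" using de mem that by (auto simp: dual_code_def)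
    also have "\<dots> = (\<Sum>j<10. of_int (left_basis ! s ! j) * e $ of_nat j)"
      by (simp add: dot_def sum_20 sum_split_20 e0 ix_of_nat del: of_nat_add)
    also have "\<dots> = e $ of_nat s"
      using that by (simp add: basis_nth if_distrib[of of_int] if_distrib[of "\<lambda>x. x * _"] cong: if_cong)
    finally show ?thesis by simp
  qed
  have all: "v = 0" if "\<And>t. t < 10 \<Longrightarrow> v $ of_nat t = 0" "\<And>t. t < 10 \<Longrightarrow> v $ of_nat (10 + t) = 0" for v :: "7 ^ 20"
  proof (rule iffD2[OF vec_eq_iff], rule allI)
    fix i :: 20
    show "v $ i = 0 $ i"
    proof (cases "ix i < 10")
      case True
      then show ?thesis using that(1)[of "ix i"] by simp
    next
      case False
      then have "ix i - 10 < 10" using ix_less[of i] by linarith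
      then show ?thesis using that(2)[of "ix i - 10"] False by (simp del: of_nat_add)
    qed
  qed
  show "y = ?l" using all[OF d0 d1] unfolding d_def by (rule eq_iff_diff_eq_0[THEN iffD2])
  show "y = ?r" using all[OF e1 e0] unfolding e_def by (rule eq_iff_diff_eq_0[THEN iffD2])
qed

text \<open>A dual vector is the combination of \<open>left_basis\<close> given by its own first ten
  coordinates, hence a codeword.\<close>

lemma self_dual_QR20: "self_dual QR20"
  unfolding self_dual_def
proof
  show "dual_code QR20 \<subseteq> QR20"
  proof
    fix y assume "y \<in> dual_code QR20"
    have "(\<Sum>s<10. y $ of_nat s *s gf_vec (left_basis ! s)) \<in> QR20"
      by (intro linear_code_sum linear_QR20 gf_vec_basis(1)) (simp add: lengths_20)
    then show "y \<in> QR20" by (subst dual_QR20_expand(1)[OF \<open>y \<in> dual_code QR20\<close>])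
  qed
qed (rule QR20_self_orthogonal)

lemma QR20_subset:
  assumes "linear_code C" "\<forall>r\<in>set left_basis. gf_vec r \<in> C"
  shows "QR20 \<subseteq> C"
proof
  fix y assume "y \<in> QR20"
  with QR20_self_orthogonal have "y \<in> dual_code QR20" by blast
  have "(\<Sum>s<10. y $ of_nat s *s gf_vec (left_basis ! s)) \<in> C"
    using assms by (intro linear_code_sum) (simp_all add: lengths_20)
  then show "y \<in> C" by (subst dual_QR20_expand(1)[OF \<open>y \<in> dual_code QR20\<close>])
qed

text \<open>Encoding with \<open>left_basis\<close> is inverted by reading off the first ten
  coordinates.\<close>

lemma card_QR20: "card QR20 = 7 ^ 10"
proof -
  define f :: "(nat \<Rightarrow> 7) \<Rightarrow> 7 ^ 20" where "f = (\<lambda>a. \<Sum>s<10. a s *s gf_vec (left_basis ! s))"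
  have f_nth: "f a $ of_nat t = a t" if "t < 10" for a t
    using that by (simp add: f_def basis_nth if_distrib[of of_int] if_distrib[of "(*) _"] cong: if_cong)
  have "inj_on f (Pi\<^sub>E {..<10} (\<lambda>_. UNIV))"
    by (intro inj_onI PiE_ext) (assumption, assumption, metis f_nth lessThan_iff)
  moreover have "f ` (Pi\<^sub>E {..<10} (\<lambda>_. UNIV)) = QR20"
  proof
    show "f ` (Pi\<^sub>E {..<10} (\<lambda>_. UNIV)) \<subseteq> QR20"
      unfolding f_def
      by (intro image_subsetI linear_code_sum linear_QR20 gf_vec_basis(1)) (simp add: lengths_20)
    show "QR20 \<subseteq> f ` (Pi\<^sub>E {..<10} (\<lambda>_. UNIV))"
    proof
      fix y assume "y \<in> QR20"
      with QR20_self_orthogonal have "y \<in> dual_code QR20" by blast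
      have "y = (\<Sum>s<10. y $ of_nat s *s gf_vec (left_basis ! s))"
        by (rule dual_QR20_expand(1)) fact
      also have "\<dots> = f (\<lambda>s\<in>{..<10}. y $ of_nat s)"
        unfolding f_def by (rule sum.cong) simp_all
      finally have "y = f (\<lambda>s\<in>{..<10}. y $ of_nat s)" .
      then show "y \<in> f ` (Pi\<^sub>E {..<10} (\<lambda>_. UNIV))"
        by (rule image_eqI[of _ f "\<lambda>s\<in>{..<10}. y $ of_nat s"]) simp
    qed
  qed
  ultimately have "card QR20 = card (Pi\<^sub>E {..<10::nat} (\<lambda>_. UNIV :: 7 set))"
    using card_image by metis
  also have "\<dots> = 7 ^ 10" by (subst card_PiE) simp_all
  finally show ?thesis .
qed

section \<open>The minimum weight of \<open>QR20\<close>\<close>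

text \<open>Fermat: z^6 = 1 modulo 7, so z^5 is the inverse.\<close>

lemma inverse_7:
  assumes "c \<noteq> (0 :: 7)"
  obtains d where "d * c = 1"
proof -
  obtain z where z: "c = of_int z" "0 \<le> z" "z < 7" by (cases c) auto
  have "z ^ 5 * z = z ^ 6" by (simp add: eval_nat_numeral)
  then have "(of_int (z ^ 5) :: 7) * of_int z = of_int (z ^ 6)" by (metis of_int_mult)
  also have "z = 1 \<or> z = 2 \<or> z = 3 \<or> z = 4 \<or> z = 5 \<or> z = 6"
    using z assms by (cases "z = 0") auto
  then have "of_int (z ^ 6) = (of_int 1 :: 7)"
    unfolding of_int_7_eq_iff by auto
  finally show thesis using z that by simp
qed

text \<open>Constructors with an addition table let the enumeration run by plain rewriting, free of
  integer arithmetic and reduction. Addition suffices, since the multiples of a row are produced by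
  adding it repeatedly.\<close>

datatype z7 = Z0 | Z1 | Z2 | Z3 | Z4 | Z5 | Z6

fun z7_val :: "z7 \<Rightarrow> 7" where
  "z7_val Z0 = 0" | "z7_val Z1 = 1" | "z7_val Z2 = 2" | "z7_val Z3 = 3"
| "z7_val Z4 = 4" | "z7_val Z5 = 5" | "z7_val Z6 = 6"

definition z7_of_int :: "int \<Rightarrow> z7" where
  "z7_of_int x = (if x = 0 then Z0 else if x = 1 then Z1 else if x = 2 then Z2 else if x = 3 then Z3
     else if x = 4 then Z4 else if x = 5 then Z5 else Z6)"

lemma z7_val_of_int: "0 \<le> x \<Longrightarrow> x < 7 \<Longrightarrow> z7_val (z7_of_int x) = of_int x"
proof -
  assume "0 \<le> x" "x < 7"
  then have "x = 0 \<or> x = 1 \<or> x = 2 \<or> x = 3 \<or> x = 4 \<or> x = 5 \<or> x = 6" by arith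
  then show ?thesis by (auto simp: z7_of_int_def)
qed

lemma z7_val_eq_0_iff: "z7_val x = 0 \<longleftrightarrow> x = Z0"
  by (cases x) simp_all

fun zadd :: "z7 \<Rightarrow> z7 \<Rightarrow> z7" where
  "zadd Z0 Z0 = Z0" | "zadd Z0 Z1 = Z1" | "zadd Z0 Z2 = Z2" | "zadd Z0 Z3 = Z3" | "zadd Z0 Z4 = Z4" | "zadd Z0 Z5 = Z5" | "zadd Z0 Z6 = Z6"
| "zadd Z1 Z0 = Z1" | "zadd Z1 Z1 = Z2" | "zadd Z1 Z2 = Z3" | "zadd Z1 Z3 = Z4" | "zadd Z1 Z4 = Z5" | "zadd Z1 Z5 = Z6" | "zadd Z1 Z6 = Z0"
| "zadd Z2 Z0 = Z2" | "zadd Z2 Z1 = Z3" | "zadd Z2 Z2 = Z4" | "zadd Z2 Z3 = Z5" | "zadd Z2 Z4 = Z6" | "zadd Z2 Z5 = Z0" | "zadd Z2 Z6 = Z1"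
| "zadd Z3 Z0 = Z3" | "zadd Z3 Z1 = Z4" | "zadd Z3 Z2 = Z5" | "zadd Z3 Z3 = Z6" | "zadd Z3 Z4 = Z0" | "zadd Z3 Z5 = Z1" | "zadd Z3 Z6 = Z2"
| "zadd Z4 Z0 = Z4" | "zadd Z4 Z1 = Z5" | "zadd Z4 Z2 = Z6" | "zadd Z4 Z3 = Z0" | "zadd Z4 Z4 = Z1" | "zadd Z4 Z5 = Z2" | "zadd Z4 Z6 = Z3"
| "zadd Z5 Z0 = Z5" | "zadd Z5 Z1 = Z6" | "zadd Z5 Z2 = Z0" | "zadd Z5 Z3 = Z1" | "zadd Z5 Z4 = Z2" | "zadd Z5 Z5 = Z3" | "zadd Z5 Z6 = Z4"
| "zadd Z6 Z0 = Z6" | "zadd Z6 Z1 = Z0" | "zadd Z6 Z2 = Z1" | "zadd Z6 Z3 = Z2" | "zadd Z6 Z4 = Z3" | "zadd Z6 Z5 = Z4" | "zadd Z6 Z6 = Z5"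

lemma z7_val_zadd: "z7_val (zadd x y) = z7_val x + z7_val y"
  by (cases x; cases y) simp_all

fun ladd :: "z7 list \<Rightarrow> z7 list \<Rightarrow> z7 list" where
  "ladd (x # xs) (y # ys) = zadd x y # ladd xs ys"
| "ladd _ _ = []"

lemma z7_val_ladd: "map z7_val (ladd xs ys) = map2 (+) (map z7_val xs) (map z7_val ys)"
  by (induction xs ys rule: ladd.induct) (simp_all add: z7_val_zadd)

text \<open>Scanning ends at the nonzero entry number w + 1; the full weight is never
  computed.\<close>

fun heavier :: "z7 list \<Rightarrow> nat \<Rightarrow> bool" where
  "heavier [] w \<longleftrightarrow> False"
| "heavier (Z0 # xs) w \<longleftrightarrow> heavier xs w"
| "heavier (x # xs) 0 \<longleftrightarrow> True"
| "heavier (x # xs) (Suc w) \<longleftrightarrow> heavier xs w"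

text \<open>\<open>combs_heavier rs a b w\<close>: adding to \<open>a\<close> a combination of the rows \<open>rs\<close> with at most \<open>b\<close> nonzero
  coefficients gives a vector whose weight, plus the number of these coefficients, exceeds \<open>w\<close>.\<close>
fun combs_heavier :: "z7 list list \<Rightarrow> z7 list \<Rightarrow> nat \<Rightarrow> nat \<Rightarrow> bool" where
  "combs_heavier [] a b w \<longleftrightarrow> heavier a w"
| "combs_heavier (r # rs) a 0 w \<longleftrightarrow> heavier a w"
| "combs_heavier (r # rs) a (Suc b) 0 \<longleftrightarrow> False"
| "combs_heavier (r # rs) a (Suc b) (Suc w) \<longleftrightarrow> combs_heavier rs a (Suc b) (Suc w) \<and>
     (let a1 = ladd a r in combs_heavier rs a1 b w \<and>
     (let a2 = ladd a1 r in combs_heavier rs a2 b w \<and>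
     (let a3 = ladd a2 r in combs_heavier rs a3 b w \<and>
     (let a4 = ladd a3 r in combs_heavier rs a4 b w \<and>
     (let a5 = ladd a4 r in combs_heavier rs a5 b w \<and>
     (let a6 = ladd a5 r in combs_heavier rs a6 b w))))))"

text \<open>Scaling preserves weights, so only combinations with first nonzero coefficient 1 are
  enumerated. That coefficient is not counted in \<open>b\<close> and \<open>w\<close>, which
  accounts for the successors in the soundness lemmas.\<close>

fun monic_combs_heavier :: "z7 list list \<Rightarrow> nat \<Rightarrow> nat \<Rightarrow> bool" where
  "monic_combs_heavier [] b w \<longleftrightarrow> True"
| "monic_combs_heavier (r # rs) b w \<longleftrightarrow> combs_heavier rs r b w \<and> monic_combs_heavier rs b w"

section \<open>Soundness of the enumeration of combinations\<close>

definition wt :: "'a::zero list \<Rightarrow> nat" where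
  "wt xs = length (filter (\<lambda>x. x \<noteq> 0) xs)"

lemma wt_simps [simp]: "wt [] = 0" "wt (x # xs) = (if x = 0 then wt xs else Suc (wt xs))"
  by (simp_all add: wt_def)

lemma heavier_iff: "heavier xs w \<longleftrightarrow> w < wt (map z7_val xs)"
  by (induction xs w rule: heavier.induct) (auto simp: z7_val_eq_0_iff)

fun comb :: "7 list \<Rightarrow> 7 list list \<Rightarrow> 7 list \<Rightarrow> 7 list" where
  "comb (c # cs) (r # rs) a = comb cs rs (map2 (\<lambda>x y. x + c * y) a r)"
| "comb _ _ a = a"

lemma map2_const: "length xs = length ys \<Longrightarrow> map2 (\<lambda>x y. x) xs ys = xs"
  by (induction xs ys rule: list_induct2) simp_all

lemma comb_zeros: "wt cs = 0 \<Longrightarrow> \<forall>r\<in>set rs. length r = length a \<Longrightarrow> comb cs rs a = a"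
proof (induction cs rs a rule: comb.induct)
  case (1 c cs r rs a)
  have c: "c = 0" "wt cs = 0" using "1.prems"(1) by (simp_all split: if_splits)
  have a: "map2 (\<lambda>x y. x + c * y) a r = a" using "1.prems"(2) by (simp add: c map2_const)
  have "comb cs rs a = a" using "1.IH" c(2) "1.prems"(2) unfolding a by simp
  then show ?case by (simp only: comb.simps a)
qed simp_all

lemma map2_add_add:
  "map2 (\<lambda>x y. x + c * y) (map2 (\<lambda>x y. x + d * y) a r) r = map2 (\<lambda>x y. x + (d + c) * y) a r"
  for c d :: "'a::comm_ring_1"
  by (induction a r rule: list_induct2') (simp_all add: algebra_simps)

text \<open>Each nonzero coefficient lowers both \<open>b\<close> and \<open>w\<close> by one, so
  the final test bounds the weight of the vector plus the number of coefficients. Rejecting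
  \<open>w = 0\<close> while \<open>b\<close> is positive is harmless for this direction.\<close>

lemma combs_heavier_sound:
  assumes "combs_heavier rs a b w" "length cs = length rs" "wt cs \<le> b"
    "\<forall>r\<in>set rs. length r = length a"
  shows "w < wt (comb cs (map (map z7_val) rs) (map z7_val a)) + wt cs"
  using assms
proof (induction rs a b w arbitrary: cs rule: combs_heavier.induct)
  case (1 a b w)
  then show ?case by (simp add: heavier_iff)
next
  case (2 r rs a w)
  then have "comb cs (map (map z7_val) (r # rs)) (map z7_val a) = map z7_val a"
    by (intro comb_zeros) auto
  with 2 show ?case by (simp add: heavier_iff)
next
  case (3 r rs a b)
  then show ?case by simp
next
  case (4 r rs a b w)
  obtain c cs' where cs: "cs = c # cs'" "length cs' = length rs"
    using "4.prems"(2) by (cases cs) auto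
  let ?V = "map z7_val" and ?R = "map (map z7_val) rs"
  have lens: "length (ladd x y) = length x" if "length x = length y" for x y
    using that by (induction x y rule: list_induct2) simp_all
  \<comment> \<open>\<open>A k\<close> is a + k r, the vector reached after k additions of the row;
    the six nonzero values of c select one of the six recursive calls.\<close>
  define A where "A k = map2 (\<lambda>x y. x + k * y) (?V a) (?V r)" for k
  define a1 a2 a3 a4 a5 a6 where "a1 = ladd a r" and "a2 = ladd a1 r" and "a3 = ladd a2 r"
    and "a4 = ladd a3 r" and "a5 = ladd a4 r" and "a6 = ladd a5 r"
  note ai = a1_def a2_def a3_def a4_def a5_def a6_def
  have st: "?V (ladd x r) = A (k + 1)" if "?V x = A k" for x k
    using map2_add_add[of 1 k "?V a" "?V r"] by (simp add: z7_val_ladd that A_def)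
  have A1: "?V a1 = A 1" by (simp add: a1_def z7_val_ladd A_def)
  have Ai: "?V a1 = A 1" "?V a2 = A 2" "?V a3 = A 3" "?V a4 = A 4" "?V a5 = A 5" "?V a6 = A 6"
    using A1 st[of a1 1] st[of a2 2] st[of a3 3] st[of a4 4] st[of a5 5] by (simp_all add: ai)
  have la: "length a1 = length a" "length a2 = length a" "length a3 = length a"
    "length a4 = length a" "length a5 = length a" "length a6 = length a"
    using "4.prems"(4) by (simp_all add: ai lens)
  have prem: "combs_heavier rs a (Suc b) (Suc w)" "combs_heavier rs a1 b w" "combs_heavier rs a2 b w"
    "combs_heavier rs a3 b w" "combs_heavier rs a4 b w" "combs_heavier rs a5 b w" "combs_heavier rs a6 b w"
    using "4.prems"(1) by (simp_all add: Let_def ai)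
  have A0: "A 0 = ?V a"
    using "4.prems"(4) by (simp add: A_def map2_const)
  obtain z where z: "c = of_int z" "0 \<le> z" "z < 7" by (cases c) auto
  show ?case
  proof (cases "c = 0")
    case True
    then show ?thesis using "4.IH"(1)[OF _ cs(2)] prem "4.prems"(3,4) cs A0 by (simp add: A_def)
  next
    case False
    then have wc: "wt cs' \<le> b" using "4.prems"(3) cs by simp
    have "w < wt (comb cs' ?R (A c)) + wt cs'"
    proof -
      have "z = 1 \<or> z = 2 \<or> z = 3 \<or> z = 4 \<or> z = 5 \<or> z = 6"
        using z False by (cases "z = 0") auto
      then consider "c = 1" | "c = 2" | "c = 3" | "c = 4" | "c = 5" | "c = 6"
        using z(1) by fastforce
      then show ?thesis
      proof cases
        case 1 then show ?thesis using "4.IH"(2)[OF _ _ cs(2) wc] prem "4.prems"(4) Ai la by (simp add: ai)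
      next
        case 2 then show ?thesis using "4.IH"(3)[OF _ _ _ cs(2) wc] prem "4.prems"(4) Ai la by (simp add: ai)
      next
        case 3 then show ?thesis using "4.IH"(4)[OF _ _ _ _ cs(2) wc] prem "4.prems"(4) Ai la by (simp add: ai)
      next
        case 4 then show ?thesis using "4.IH"(5)[OF _ _ _ _ _ cs(2) wc] prem "4.prems"(4) Ai la by (simp add: ai)
      next
        case 5 then show ?thesis using "4.IH"(6)[OF _ _ _ _ _ _ cs(2) wc] prem "4.prems"(4) Ai la by (simp add: ai)
      next
        case 6 then show ?thesis using "4.IH"(7)[OF _ _ _ _ _ _ _ cs(2) wc] prem "4.prems"(4) Ai la by (simp add: ai)
      qed
    qed
    then show ?thesis using False cs by (simp add: A_def)
  qed
qed

lemma comb_unit: "comb (1 # cs) (r # rs) (replicate (length r) 0) = comb cs rs r"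
proof -
  have "map2 (\<lambda>x y. x + 1 * y) (replicate (length r) 0) r = r" by (induction r) simp_all
  then show ?thesis by simp
qed

lemma monic_combs_heavier_sound:
  assumes "monic_combs_heavier rs b w" "length cs = length rs" "wt cs \<le> Suc b"
    "\<forall>r\<in>set rs. length r = n" "cs = replicate k 0 @ 1 # cs'"
  shows "Suc w < wt (comb cs (map (map z7_val) rs) (replicate n 0)) + wt cs"
  using assms
proof (induction rs b w arbitrary: cs k rule: monic_combs_heavier.induct)
  case (2 r rs b w)
  have n: "length r = n" using "2.prems"(4) by simp
  show ?case
  proof (cases k)
    case 0
    have "w < wt (comb cs' (map (map z7_val) rs) (map z7_val r)) + wt cs'"
      using 2 0 by (intro combs_heavier_sound[where b = b]) auto
    moreover have "comb cs (map (map z7_val) (r # rs)) (replicate n 0) =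
        comb cs' (map (map z7_val) rs) (map z7_val r)"
      using comb_unit[of cs' "map z7_val r"] 0 "2.prems"(5) n by simp
    ultimately show ?thesis using 0 "2.prems"(5) by simp
  next
    case (Suc k')
    define ds where "ds = replicate k' (0 :: 7) @ 1 # cs'"
    have cs: "cs = 0 # ds" using Suc "2.prems"(5) by (simp add: ds_def)
    have "Suc w < wt (comb ds (map (map z7_val) rs) (replicate n 0)) + wt ds"
      using "2.prems"(1-4) unfolding cs
      by (intro "2.IH"[where k = k']) (simp_all, simp add: ds_def)
    then show ?thesis using n by (simp add: cs map2_const)
  qed
qed simp

lemma comb_scale:
  "comb (map ((*) d) cs) rs (map ((*) d) a) = map ((*) d) (comb cs rs a)"
proof (induction cs rs a rule: comb.induct)
  case (1 c cs r rs a)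
  have "map2 (\<lambda>x y. x + d * c * y) (map ((*) d) a) r = map ((*) d) (map2 (\<lambda>x y. x + c * y) a r)"
    by (induction a r rule: list_induct2') (simp_all add: algebra_simps)
  with 1 show ?case by simp
qed simp_all

lemma wt_scale: "e * d = 1 \<Longrightarrow> wt (map ((*) d) xs) = wt xs"
  for d :: "'a::comm_ring_1"
proof -
  assume ed: "e * d = 1"
  have "d * x = 0 \<longleftrightarrow> x = 0" for x
    using ed by (metis mult.assoc mult_1 mult_zero_right)
  then show ?thesis by (simp add: wt_def filter_map o_def)
qed

text \<open>Multiplying by the inverse of the first nonzero coefficient makes the combination monic
  and leaves both weights unchanged.\<close>

lemma comb_heavy:
  assumes "monic_combs_heavier rs b w" "length cs = length rs" "wt cs \<le> Suc b"
    "\<forall>r\<in>set rs. length r = n" "wt cs \<noteq> 0"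
  shows "Suc w < wt (comb cs (map (map z7_val) rs) (replicate n 0)) + wt cs"
proof -
  from \<open>wt cs \<noteq> 0\<close> obtain k c cs' where cs: "cs = replicate k 0 @ c # cs'" "c \<noteq> 0"
  proof (induction cs arbitrary: thesis)
    case (Cons c cs)
    show ?case
    proof (cases "c = 0")
      case True
      then obtain k e es where "cs = replicate k 0 @ e # es" "e \<noteq> 0"
        using Cons by auto
      with True show ?thesis by (intro Cons.prems(1)[of "Suc k" e es]) auto
    next
      case False
      then show ?thesis by (intro Cons.prems(1)[of 0 c cs]) auto
    qed
  qed simp
  obtain d where d: "d * c = 1" using inverse_7[OF cs(2)] .
  have cd: "c * d = 1" using d by (simp add: mult.commute)
  let ?R = "map (map z7_val) rs"
  have "Suc w < wt (comb (map ((*) d) cs) ?R (replicate n 0)) + wt (map ((*) d) cs)"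
  proof (rule monic_combs_heavier_sound[OF assms(1) _ _ assms(4)])
    show "map ((*) d) cs = replicate k 0 @ 1 # map ((*) d) cs'" by (simp add: cs(1) d)
  qed (simp_all add: assms(2,3) wt_scale[OF cd])
  then show ?thesis
    using comb_scale[of d cs ?R "replicate n 0"] by (simp add: wt_scale[OF cd])
qed

lemma comb_nth:
  assumes "length cs = length rs" "\<forall>r\<in>set rs. length r = length a" "t < length a"
  shows "length (comb cs rs a) = length a \<and> comb cs rs a ! t = a ! t + (\<Sum>s<length cs. cs ! s * rs ! s ! t)"
  using assms
proof (induction cs rs a rule: comb.induct)
  case (1 c cs r rs a)
  then show ?case
    by (simp add: sum.lessThan_Suc_shift add.assoc del: sum.lessThan_Suc)
qed auto

text \<open>With the leading coefficient added, 3 and 7 become: at most 4 nonzero coefficients,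
  total weight above 8.\<close>

lemma monic_combs_heavier_right: "monic_combs_heavier (map (map z7_of_int) right_block) 3 7"
  by code_simp

lemma monic_combs_heavier_left: "monic_combs_heavier (map (map z7_of_int) left_block) 3 7"
  by code_simp

lemma block_comb_heavy:
  fixes f g :: "nat \<Rightarrow> 7"
  assumes "monic_combs_heavier (map (map z7_of_int) B) 3 7"
    "length B = 10" "\<forall>r\<in>set B. length r = 10 \<and> (\<forall>x\<in>set r. 0 \<le> x \<and> x < 7)"
    "\<And>t. t < 10 \<Longrightarrow> g t = (\<Sum>s<10. f s * of_int (B ! s ! t))"
    "wt (map f [0..<10]) \<noteq> 0" "wt (map f [0..<10]) \<le> 4"
  shows "8 < wt (map g [0..<10]) + wt (map f [0..<10])"
proof -
  have R: "map (map z7_val) (map (map z7_of_int) B) = map (map of_int) B"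
    using assms(3) by (simp add: z7_val_of_int)
  have len: "length (comb (map f [0..<10]) (map (map of_int) B) (replicate 10 0)) = 10"
    using comb_nth[of "map f [0..<10]" "map (map of_int) B" "replicate 10 0" 0] assms(2,3) by simp
  have "comb (map f [0..<10]) (map (map of_int) B) (replicate 10 0) = map g [0..<10]"
  proof (rule nth_equalityI)
    fix t assume "t < length (comb (map f [0..<10]) (map (map of_int) B) (replicate 10 0))"
    then have t: "t < 10" using len by simp
    have *: "B ! s \<in> set B" if "s < 10" for s using that assms(2) by simp
    have "comb (map f [0..<10]) (map (map of_int) B) (replicate 10 0) ! t =
        (\<Sum>s<10. map f [0..<10] ! s * map (map of_int) B ! s ! t)"
      using comb_nth[of "map f [0..<10]" "map (map of_int) B" "replicate 10 0" t] assms(2,3) t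
      by (simp del: upt_rec_numeral)
    also have "\<dots> = (\<Sum>s<10. f s * of_int (B ! s ! t))"
      using assms(2,3) t * by (intro sum.cong) (simp_all del: upt_rec_numeral)
    finally show "comb (map f [0..<10]) (map (map of_int) B) (replicate 10 0) ! t = map g [0..<10] ! t"
      using t by (simp add: assms(4) del: upt_rec_numeral)
  qed (simp add: len)
  moreover have "Suc 7 < wt (comb (map f [0..<10]) (map (map z7_val) (map (map z7_of_int) B)) (replicate 10 0))
      + wt (map f [0..<10])"
    using assms(2,3,5,6) by (intro comb_heavy[OF assms(1)]) simp_all
  ultimately show ?thesis unfolding R by simp
qed

lemma wt_upt: "wt (map f [0..<n]) = (\<Sum>t<n. if f t = 0 then 0 else 1)"
  by (induction n) (simp_all add: wt_def)

lemma hamming_weight_halves: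
  "hamming_weight y = wt (map (\<lambda>t. y $ of_nat t) [0..<10]) + wt (map (\<lambda>t. y $ of_nat (10 + t)) [0..<10])"
  for y :: "'a::zero ^ 20"
proof -
  have "hamming_weight y = (\<Sum>i\<in>UNIV. if y $ i = 0 then 0 else 1)"
    by (simp add: hamming_weight_def sum.If_cases Collect_neg_eq)
  then show ?thesis
    by (simp add: sum_20 sum_split_20 wt_upt del: of_nat_add upt_rec_numeral)
qed

lemma QR20_min_weight:
  assumes "y \<in> QR20" "y \<noteq> 0"
  shows "9 \<le> hamming_weight y"
proof -
  have y: "y \<in> dual_code QR20" using assms(1) QR20_self_orthogonal by blast
  define f g where "f = (\<lambda>t::nat. y $ of_nat t)" and "g = (\<lambda>t::nat. y $ of_nat (10 + t))"
  let ?L = "\<lambda>h. wt (map h [0..<10])"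
  have fg: "g t = (\<Sum>s<10. f s * of_int (right_block ! s ! t))" "f t = (\<Sum>s<10. g s * of_int (left_block ! s ! t))"
    if "t < 10" for t
  proof -
    have "y $ of_nat (10 + t) = (\<Sum>s<10. y $ of_nat s *s gf_vec (left_basis ! s)) $ of_nat (10 + t)"
      by (rule arg_cong[where f = "\<lambda>v. v $ _"], rule dual_QR20_expand(1)[OF y])
    then show "g t = (\<Sum>s<10. f s * of_int (right_block ! s ! t))"
      using that ix_of_nat[of "10 + t"] by (simp add: f_def g_def basis_nth del: of_nat_add)
    have "y $ of_nat t = (\<Sum>s<10. y $ of_nat (10 + s) *s gf_vec (right_basis ! s)) $ of_nat t"
      by (rule arg_cong[where f = "\<lambda>v. v $ _"], rule dual_QR20_expand(2)[OF y])
    then show "f t = (\<Sum>s<10. g s * of_int (left_block ! s ! t))"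
      using that by (simp add: f_def g_def basis_nth del: of_nat_add)
  qed
  have blocks: "length right_block = 10" "length left_block = 10"
    "\<forall>r\<in>set right_block. length r = 10 \<and> (\<forall>x\<in>set r. 0 \<le> x \<and> x < 7)"
    "\<forall>r\<in>set left_block. length r = 10 \<and> (\<forall>x\<in>set r. 0 \<le> x \<and> x < 7)"
    by code_simp+
  have w: "hamming_weight y = ?L f + ?L g"
    unfolding f_def g_def by (rule hamming_weight_halves)
  have zero: "h t = 0" if "?L h = 0" "t < 10" for h :: "nat \<Rightarrow> 7" and t
    using that by (simp add: wt_def filter_empty_conv del: upt_rec_numeral)
  \<comment> \<open>The enumeration speaks only about nonzero coefficient vectors. Each half
    determines the other linearly, so a word that vanishes on one half is zero.\<close>
  have nz: "?L f \<noteq> 0 \<and> ?L g \<noteq> 0"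
  proof (rule ccontr)
    assume "\<not> (?L f \<noteq> 0 \<and> ?L g \<noteq> 0)"
    then have "(\<forall>t<10. f t = 0) \<or> (\<forall>t<10. g t = 0)" using zero by blast
    then have "\<forall>t<10. f t = 0 \<and> g t = 0"
    proof
      assume f: "\<forall>t<10. f t = 0"
      then have "g t = 0" if "t < 10" for t unfolding fg(1)[OF that] by (intro sum.neutral) simp
      with f show ?thesis by blast
    next
      assume g: "\<forall>t<10. g t = 0"
      then have "f t = 0" if "t < 10" for t unfolding fg(2)[OF that] by (intro sum.neutral) simp
      with g show ?thesis by blast
    qed
    then have all: "f t = 0 \<and> g t = 0" if "t < 10" for t using that by blast
    have "y $ i = 0" for i
    proof (cases "ix i < 10")
      case True
      then show ?thesis using all[of "ix i"] by (simp add: f_def)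
    next
      case False
      moreover have "ix i - 10 < 10" using ix_less[of i] by linarith
      ultimately show ?thesis using all[of "ix i - 10"] by (simp add: g_def del: of_nat_add)
    qed
    then show False using \<open>y \<noteq> 0\<close> by (simp add: vec_eq_iff)
  qed
  show ?thesis
  proof (rule ccontr)
    assume "\<not> 9 \<le> hamming_weight y"
    then consider "?L f \<le> 4" | "?L g \<le> 4" using w by linarith
    then show False
    proof cases
      case 1
      from block_comb_heavy[OF monic_combs_heavier_right blocks(1,3) fg(1) conjunct1[OF nz] 1]
      show False using w \<open>\<not> 9 \<le> hamming_weight y\<close> by linarith
    next
      case 2
      from block_comb_heavy[OF monic_combs_heavier_left blocks(2,4) fg(2) conjunct2[OF nz] 2]
      show False using w \<open>\<not> 9 \<le> hamming_weight y\<close> by linarith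
    qed
  qed
qed

lemma min_distance_le:
  fixes C :: "('a::{zero,finite} ^ 'n) set"
  assumes "c \<in> C" "c \<noteq> 0"
  shows "min_distance C \<le> hamming_weight c"
proof -
  have "finite {hamming_weight c | c. c \<in> C \<and> c \<noteq> 0}" by simp
  then show ?thesis unfolding min_distance_def using assms by (intro Min_le) auto
qed

lemma is_code_QR20: "is_code QR20 10 9"
proof -
  \<comment> \<open>Row 6 of \<open>right_block\<close> has exactly two zeros, so this basis word
    attains weight 1 + 8.\<close>
  define c where "c = gf_vec (left_basis ! 6)"
  have len: "length (left_basis ! 6) = 20" and w: "length (filter (\<lambda>x. x mod 7 \<noteq> 0) (left_basis ! 6)) = 9"
    by code_simp+
  have hw: "hamming_weight c = 9" unfolding c_def hamming_weight_vec[OF len] by (rule w)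
  then have "c \<noteq> 0" by (auto simp: hamming_weight_def)
  have "c \<in> QR20" unfolding c_def by (intro gf_vec_basis(1) nth_mem) (simp add: lengths_20)
  have "min_distance QR20 = 9"
    unfolding min_distance_def
  proof (rule Min_eqI)
    show "9 \<in> {hamming_weight c | c. c \<in> QR20 \<and> c \<noteq> 0}"
      using hw \<open>c \<noteq> 0\<close> \<open>c \<in> QR20\<close> by force
  qed (auto simp: QR20_min_weight)
  then show ?thesis by (simp add: is_code_def linear_QR20 card_QR20)
qed

section \<open>Search for normalised frames\<close>

type_synonym classes = "(int list \<times> int) list"

text \<open>A state of the search consists of the columns of the chosen rows at the chosen vertices, and of the
  remaining columns with multiplicities; both list the most recently chosen row first. The
  certificate names a combination of rows of low weight, or the class of the next vertex, or
  vertices of the Paley matrix realising the state together with coefficients that express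
  \<open>left_basis\<close> by their rows.\<close>
datatype cert = Low "int list" | Branch nat "cert list" | Leaf "nat list" "int list list"

definition put :: "int list \<Rightarrow> int \<Rightarrow> classes \<Rightarrow> classes" where
  "put q n cs = (if n = 0 then cs else (q, n) # cs)"

text \<open>Here \<open>m\<close> is the number of columns still to be split and \<open>t\<close>
  holds the partial inner products of the new row with the older rows. One column changes an entry
  of \<open>t\<close> by at most 1, which justifies the pruning test. In a class of equal columns
  only the number \<open>a\<close> of new entries +1 matters.\<close>

fun splits :: "int \<Rightarrow> int list \<Rightarrow> classes \<Rightarrow> classes list" where
  "splits m t [] = (if list_all (\<lambda>x. x = 0) t then [[]] else [])"
| "splits m t (c # cs) =
    (if list_all (\<lambda>x. x \<le> m \<and> - m \<le> x) t then
       concat (map (\<lambda>a. map (\<lambda>ds. put (1 # fst c) a (put (-1 # fst c) (snd c - a) ds))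
         (splits (m - snd c) (map2 (\<lambda>x y. x + (2 * a - snd c) * y) t (fst c)) cs)) [0..snd c])
     else [])"

text \<open>The column \<open>q\<close> of the new vertex lists the entries of the older rows there;
  by skewness the new row has the opposite entries at the older vertices, and its diagonal entry is
  3.\<close>

definition new_columns :: "int list \<Rightarrow> int list list \<Rightarrow> int list list" where
  "new_columns q D = (3 # q) # map2 (\<lambda>d x. - x # d) D q"

text \<open>The inner products of the new row with the old ones, restricted to the chosen vertices.\<close>
definition residual :: "int list list \<Rightarrow> int list" where
  "residual D = foldr (\<lambda>d t. map2 (\<lambda>x y. x + hd d * y) t (tl d)) D (replicate (length (tl (hd D))) 0)"

definition remove_class :: "nat \<Rightarrow> classes \<Rightarrow> classes" where
  "remove_class i cs = take i cs @ put (fst (cs ! i)) (snd (cs ! i) - 1) (drop (Suc i) cs)"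

text \<open>\<open>ldot\<close> truncates to the shorter list, so coefficients omitted at the end of
  \<open>c\<close>, those of the oldest rows, are zero.\<close>

definition comb_weight :: "int list \<Rightarrow> int list list \<Rightarrow> classes \<Rightarrow> int" where
  "comb_weight c D cs =
     sum_list (map (\<lambda>d. if ldot c d mod 7 = 0 then 0 else 1) D) +
     sum_list (map (\<lambda>d. if ldot c (fst d) mod 7 = 0 then 0 else snd d) cs)"

fun same_mset :: "'a list \<Rightarrow> 'a list \<Rightarrow> bool" where
  "same_mset [] ys \<longleftrightarrow> ys = []"
| "same_mset (x # xs) ys \<longleftrightarrow> x \<in> set ys \<and> same_mset xs (remove1 x ys)"

text \<open>In a \<open>Branch\<close> all vertices of a class are interchangeable, since the state
  records only columns; each admissible split needs its own certificate, and an empty list closes a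
  branch in which no row is orthogonal to the others.\<close>

fun check :: "int list list \<Rightarrow> classes \<Rightarrow> cert \<Rightarrow> bool" where
  "check D cs (Low c) \<longleftrightarrow> (let w = comb_weight c D cs in 0 < w \<and> w < 9)"
| "check D cs (Branch i ts) \<longleftrightarrow> i < length cs \<and> 0 < snd (cs ! i) \<and>
     (let E = new_columns (fst (cs ! i)) D; rs = remove_class i cs in
      list_all2 (\<lambda>ds t. check E ds t) (splits (sum_list (map snd rs)) (residual E) rs) ts)"
| "check D cs (Leaf ps co) \<longleftrightarrow> length ps = length (hd D) \<and> (\<forall>p\<in>set ps. p < 20) \<and>
     same_mset (D @ concat (map (\<lambda>c. replicate (nat (snd c)) (fst c)) cs))
       (map (\<lambda>j. map (\<lambda>p. paley ! p ! j) ps) [0..<20]) \<and>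
     spans co (map (\<lambda>p. paley ! p) ps) left_basis"

text \<open>There are four leaves with ten vertices each. All end in 19, the Paley vertex whose row
  has only entries 1 off the diagonal and which therefore takes the place of the starting
  vertex.\<close>

definition search_cert :: cert where
  "search_cert =
   Branch 0 [Branch 0 [Branch 3 [Low [1,1,1,-1], Branch 0 [Low [1,0,1,1,-1], Branch 3 [Low [1,0,1,1,1],
   Low [1,0,1,1,0,1], Low [1,0,1,0,1,1], Branch 7 [Branch 3 [Branch 10 [Branch 2 [Leaf
   [17,13,4,10,9,7,3,1,0,19] [[-2,3,0,-1,-1,-2,0,-3,-2,-3], [-1,2,-3,1,-1,1,-2,0,-2,1],
   [3,1,0,-1,3,-1,0,-1,2,-2], [3,0,-1,-1,-3,2,1,0,-3,3], [1,-3,-3,2,-2,3,-2,1,2,-3],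
   [0,-1,-3,1,-2,-1,1,3,0,3], [0,0,2,-1,3,-3,3,-2,2,-1], [0,1,-1,-2,-1,-1,1,-1,-2,2],
   [-1,2,1,1,-1,-3,-1,-2,2,0], [-3,2,1,1,-2,-2,-1,-2,1,1]]]]], Low [1,1,1,0,1], Low [1,1,0,1,1], Low
   [1,-1,0,0,1,-1], Low [1,1,0,1,1]], Branch 8 [Low [1,1,1,0,0,1], Branch 12 [Low [1,0,0,1,1,0,0,-1]],
   Branch 6 [Low [1,0,0,1,1,0,0,1]], Low [1,1,1,0,0,1], Low [1,-1,0,0,1,-1], Low [1,1,1,1], Low
   [1,1,0,1,0,1], Low [1,0,0,1,0,1,1], Branch 8 [Low [1,0,0,1,-1,-1], Low [1,0,-1,1,-1], Low
   [1,0,-1,1,0,1], Low [1,0,0,1,0,1,0,1], Low [1,1,0,1,-1]]], Low [1,0,1,0,1,1], Low [1,1,0,1,1]], Low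
   [1,1,1,0,1], Branch 10 [Low [1,1,0,1,0,1], Low [1,0,1,1,1], Low [1,1,1,1], Low [1,0,1,0,1,1], Low
   [1,1,0,1,0,1], Low [1,1,0,1,0,1], Low [1,1,1,0,0,-1], Low [1,0,0,1,1,1]], Branch 9 [Low [1,0,1,1,1],
   Low [1,1,0,0,1,-1], Low [1,1,1,0,0,-1], Low [1,1,1,1], Low [1,0,1,0,1,1], Low [1,1,1,0,0,-1], Low
   [1,1,0,1,1], Low [1,1,1,0,0,-1]], Branch 3 [Low [1,0,1,1,1], Low [1,0,1,1,0,1], Low [1,0,1,0,1,1],
   Low [1,1,0,1,0,-1], Low [1,1,0,0,1,-1], Low [1,1,0,1,0,-1], Low [1,1,0,1,0,-1], Low [1,1,0,1,1]],
   Branch 6 [Branch 1 [Low [1,0,1,-1,0,-1], Low [1,1,0,0,-1,-1]], Branch 7 [Branch 11 [Low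
   [1,0,0,0,0,1,1,1]], Branch 9 [], Low [1,1,1,0,0,-1], Low [1,1,1,0,0,0,-1], Low [1,1,0,1,0,1], Low
   [1,1,0,1,0,0,1], Low [1,1,0,0,0,1,1], Low [1,1,0,0,-1,-1], Low [1,1,0,0,1,0,1], Low [1,1,1,0,1], Low
   [1,1,0,0,0,1,1], Low [1,0,1,0,-1,-1]], Branch 1 [Low [1,1,0,-1,0,-1], Branch 3 [], Low
   [1,0,1,-1,1]], Low [1,1,0,1,0,1], Branch 4 [Branch 12 [], Branch 4 [Branch 9 [Branch 3 [Leaf
   [11,15,4,16,10,6,14,1,0,19] [[1,1,3,-1,-3,-1,0,0,3,3], [3,-3,0,3,-1,1,-1,-1,1,1],
   [0,0,0,3,0,0,-3,0,3,-3], [-3,2,-3,-1,-2,-1,2,2,-1,2], [-2,-1,3,-3,0,3,-1,-1,3,0],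
   [-3,-3,2,2,-2,0,0,-3,-3,-2], [-2,3,1,-2,-3,-3,2,2,-3,3], [2,0,-2,1,1,1,2,2,-3,3],
   [-3,-1,-1,-3,-1,0,1,-2,-3,1], [0,2,-3,1,-3,0,-2,1,3,0]]]]], Low [1,1,-1,-1], Low [1,0,0,0,1,1,1]],
   Branch 10 [Low [1,0,1,-1,-1], Low [1,1,0,0,-1,-1]]]], Branch 2 [Low [1,0,1,1,-1], Branch 10 [Low
   [1,1,1,0,1], Low [1,1,1,0,1], Low [1,1,1,1], Low [1,1,1,0,1], Low [1,1,0,1,0,1], Low [1,1,0,0,1,1],
   Low [1,0,1,1,0,-1], Low [1,0,1,0,1,1]], Branch 9 [Low [1,0,0,1,1,-1], Low [1,1,1,0,1], Low
   [1,0,1,1,0,-1], Low [1,1,1,1], Low [1,1,0,1,1], Low [1,1,0,1,1], Low [1,1,0,1,1], Low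
   [1,0,1,0,1,1]], Branch 4 [Low [1,-1,0,1,-1], Branch 2 [Low [1,1,-1,-1], Branch 1 [Branch 8 [Branch 5
   [Leaf [12,10,5,6,2,16,15,1,0,19] [[3,3,1,-3,2,-1,1,3,1,3], [-3,-1,0,0,1,1,2,3,-1,1],
   [2,0,2,-1,-2,1,2,3,0,3], [2,-1,2,-1,-1,2,-3,2,-1,-3], [-2,-1,0,-1,2,0,0,0,1,-3],
   [0,2,2,0,-2,0,0,0,0,2], [2,-1,-1,-3,2,-3,-3,1,3,-1], [3,-3,0,-2,2,-3,2,3,1,-2],
   [-1,-3,-3,-1,-2,3,2,-2,-2,0], [1,-2,-3,-2,-2,0,-3,1,-2,1]]]]], Branch 2 [], Low [1,0,0,0,1,1,1]],
   Branch 10 [Low [1,1,0,0,1,0,-1], Low [1,0,1,1,1]], Branch 6 [Low [1,0,1,1,0,0,1], Low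
   [1,1,0,0,1,0,1]], Branch 7 [Low [1,0,-1,0,1,-1], Low [1,1,0,0,0,1,-1], Low [1,1,0,0,1,0,-1], Branch
   9 [Low [1,0,0,0,1,-1,1]], Branch 7 [], Low [1,1,0,0,-1,-1], Low [1,1,-1,0,0,-1], Low [1,1,-1,0,-1],
   Low [1,1,0,1,0,0,1], Low [1,1,0,1,0,1], Low [1,1,0,1,1], Low [1,1,0,0,-1,-1]], Branch 4 [Low
   [1,1,0,1,0,0,-1], Branch 7 [], Low [1,0,1,1,1]]], Low [1,1,1,1], Branch 0 [Low [1,0,1,0,1,-1], Low
   [1,0,1,0,1,-1], Low [1,0,1,1,1], Low [1,0,1,1,0,1], Branch 10 [Branch 2 [Low [1,0,0,1,1,0,0,1], Low
   [1,1,0,0,-1,0,-1], Low [1,1,0,0,1,0,0,1], Low [1,0,0,-1,1,-1], Low [1,1,0,1,1]], Low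
   [1,1,1,0,0,0,1], Low [1,1,1,1], Low [1,1,0,1,0,0,-1], Low [1,1,0,0,1,0,1], Branch 11 [Low
   [1,0,0,1,1,0,1]], Branch 8 [Low [1,0,0,-1,1,0,1]], Low [1,1,1,0,0,0,1], Low [1,0,0,1,0,1,1]], Branch
   0 [Low [1,1,-1,0,-1], Low [1,1,0,0,1,0,-1], Branch 9 [Branch 3 [Branch 7 [Leaf
   [8,16,2,5,17,11,13,1,0,19] [[-3,0,-3,2,-1,-3,3,3,-1,1], [2,2,2,1,-2,-3,-2,0,-2,2],
   [0,-2,0,-1,-3,-1,2,-2,0,3], [0,-3,2,1,-2,1,0,2,0,-3], [-3,2,2,2,1,-3,1,3,-1,1],
   [1,1,-1,3,-2,-2,3,2,3,-3], [-3,0,-1,2,2,2,-2,1,1,3], [1,-1,3,-1,3,3,0,0,-2,-1],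
   [-3,-2,2,2,-3,-3,1,3,2,-2], [1,3,1,3,0,2,1,2,0,0]]]]], Low [1,1,0,0,1,1], Low [1,1,0,0,1,1]], Low
   [1,1,0,1,0,-1]], Branch 0 [Low [1,0,1,0,1,-1], Low [1,1,0,1,1], Low [1,1,0,1,1], Low [1,0,1,1,1],
   Low [1,0,1,1,0,1], Low [1,1,0,0,1,-1], Low [1,1,0,1,0,-1], Low [1,1,0,1,1]]], Low [1,1,1,1]]]]"

lemma check_search_cert: "check [[3]] [([1], 19)] search_cert"
  by code_simp

section \<open>Soundness of the certificates\<close>

definition expand :: "classes \<Rightarrow> int list multiset" where
  "expand cs = (\<Sum>c\<leftarrow>cs. replicate_mset (nat (snd c)) (fst c))"

lemma expand_simps [simp]:
  "expand [] = {#}" "expand (c # cs) = replicate_mset (nat (snd c)) (fst c) + expand cs"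
  "expand (cs @ ds) = expand cs + expand ds"
  by (simp_all add: expand_def)

lemma expand_put [simp]: "expand (put q n cs) = replicate_mset (nat n) q + expand cs"
  by (simp add: put_def)

lemma put_pos: "0 \<le> n \<Longrightarrow> \<forall>c\<in>set cs. 0 < snd c \<Longrightarrow> \<forall>c\<in>set (put q n cs). 0 < snd c"
  by (simp add: put_def)

lemma size_expand: "\<forall>c\<in>set cs. 0 < snd c \<Longrightarrow> int (size (expand cs)) = sum_list (map snd cs)"
  by (induction cs) simp_all

lemma sum_expand: "\<forall>c\<in>set cs. 0 < snd c \<Longrightarrow>
    (\<Sum>q\<in>#expand cs. h q) = (\<Sum>c\<leftarrow>cs. h (fst c) * snd c)" for h :: "int list \<Rightarrow> int"
  by (induction cs) (simp_all add: mult.commute)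

lemma sum_mset_bound:
  fixes f :: "'a \<Rightarrow> int"
  shows "(\<And>x. x \<in># M \<Longrightarrow> \<bar>f x\<bar> \<le> 1) \<Longrightarrow> \<bar>\<Sum>x\<in>#M. f x\<bar> \<le> int (size M)"
proof (induction M)
  case (add x M)
  then have "\<bar>f x\<bar> \<le> 1" "\<bar>\<Sum>x\<in>#M. f x\<bar> \<le> int (size M)" by auto
  then show ?case by simp
qed simp

lemma sum_Compl_split: "sum f UNIV = sum f A + sum f (- A)" for A :: "'a::finite set"
  using sum.subset_diff[of A UNIV f] by (simp add: Compl_eq_Diff_UNIV add.commute)

text \<open>The multiset \<open>M\<close> pairs the entry of the new row with the old column at each
  remaining coordinate. Forgetting coordinates is harmless, because orthogonality is a sum over
  these pairs.\<close>

lemma splits_complete: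
  assumes "image_mset snd M = expand cs" "\<forall>c\<in>set cs. 0 < snd c"
    "\<And>p. p \<in># M \<Longrightarrow> (fst p = 1 \<or> fst p = - 1) \<and> length (snd p) = length t \<and> (\<forall>x\<in>set (snd p). \<bar>x\<bar> \<le> 1)"
    "int (size M) = m"
    "\<And>j. j < length t \<Longrightarrow> t ! j + (\<Sum>p\<in>#M. fst p * snd p ! j) = 0"
  shows "\<exists>ds\<in>set (splits m t cs). image_mset (\<lambda>p. fst p # snd p) M = expand ds \<and> (\<forall>c\<in>set ds. 0 < snd c)"
  using assms
proof (induction cs arbitrary: M m t)
  case Nil
  then have "M = {#}" by simp
  with Nil(5) show ?case by (simp add: list_all_length)
next
  case (Cons c cs)
  define q n where "q = fst c" and "n = snd c"
  have n: "0 < n" using Cons.prems(2) by (simp add: n_def)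
  have "image_mset snd M = replicate_mset (nat n) q + expand cs"
    using Cons.prems(1) by (simp add: q_def n_def)
  then obtain M1 M2 where M: "M = M1 + M2" "replicate_mset (nat n) q = image_mset snd M1"
      "expand cs = image_mset snd M2"
    by (metis image_mset_eq_plusD)
  have snd1: "snd p = q" if "p \<in># M1" for p
  proof -
    have "snd p \<in># replicate_mset (nat n) q" using that M(2) by simp
    then show ?thesis by (simp split: if_splits)
  qed
  have size1: "size M1 = nat n" using M(2) by (metis size_image_mset size_replicate_mset)
  \<comment> \<open>All columns in \<open>M1\<close> equal \<open>q\<close>, so the new row acts on
    this class only through the size of \<open>P\<close>, the value of \<open>a\<close> tried by
    \<open>splits\<close>.\<close>
  define P N where "P = filter_mset (\<lambda>p. fst p = 1) M1" and "N = filter_mset (\<lambda>p. fst p \<noteq> 1) M1"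
  have PN: "M1 = P + N" unfolding P_def N_def by (rule multiset_partition)
  have P: "p = (1, q)" if "p \<in># P" for p
    using that snd1 by (cases p) (auto simp: P_def)
  have N: "p = (- 1, q)" if "p \<in># N" for p
  proof -
    have "p \<in># M1" "fst p \<noteq> 1" using that by (auto simp: N_def)
    moreover from this have "fst p = 1 \<or> fst p = - 1" using Cons.prems(3)[of p] M(1) by simp
    ultimately show ?thesis using snd1 by (metis prod.collapse)
  qed
  define a where "a = int (size P)"
  have sN: "int (size N) = n - a" using size1 n PN by (simp add: a_def)
  then have a: "0 \<le> a" "a \<le> n" by (simp_all add: a_def)
  have imP: "image_mset f P = replicate_mset (nat a) (f (1, q))" for f :: "int \<times> int list \<Rightarrow> 'b"
  proof -
    have "image_mset f P = image_mset (\<lambda>_. f (1, q)) P" using P by (intro image_mset_cong) blast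
    then show ?thesis by (simp add: image_mset_const_eq a_def)
  qed
  have imN: "image_mset f N = replicate_mset (nat (n - a)) (f (- 1, q))" for f :: "int \<times> int list \<Rightarrow> 'b"
  proof -
    have "image_mset f N = image_mset (\<lambda>_. f (- 1, q)) N" using N by (intro image_mset_cong) blast
    then show ?thesis by (simp add: image_mset_const_eq flip: sN)
  qed
  have sum1: "(\<Sum>p\<in>#M1. fst p * snd p ! j) = (2 * a - n) * q ! j" for j
    using a by (simp add: PN imP imN algebra_simps)
  have lq: "length q = length t"
  proof -
    have "M1 \<noteq> {#}" using size1 n by auto
    then obtain p where p: "p \<in># M1" by blast
    then have "length (snd p) = length t" using Cons.prems(3)[of p] M(1) by simp
    then show ?thesis using snd1[OF p] by simp
  qed
  have bound: "list_all (\<lambda>x. x \<le> m \<and> - m \<le> x) t"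
    unfolding list_all_length
  proof (intro allI impI)
    fix j assume j: "j < length t"
    have "\<bar>\<Sum>p\<in>#M. fst p * snd p ! j\<bar> \<le> int (size M)"
    proof (rule sum_mset_bound)
      fix p assume "p \<in># M"
      from Cons.prems(3)[OF this] have p: "fst p = 1 \<or> fst p = - 1" "\<bar>snd p ! j\<bar> \<le> 1"
        using j by simp_all
      then show "\<bar>fst p * snd p ! j\<bar> \<le> 1" by (elim disjE) simp_all
    qed
    with Cons.prems(5)[OF j] Cons.prems(4) show "t ! j \<le> m \<and> - m \<le> t ! j" by linarith
  qed
  define t' where "t' = map2 (\<lambda>x y. x + (2 * a - n) * y) t q"
  have lt': "length t' = length t" using lq by (simp add: t'_def)
  have "\<exists>ds\<in>set (splits (m - n) t' cs). image_mset (\<lambda>p. fst p # snd p) M2 = expand ds \<and> (\<forall>c\<in>set ds. 0 < snd c)"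
  proof (rule Cons.IH)
    show "image_mset snd M2 = expand cs" using M(3) by simp
    show "\<forall>c\<in>set cs. 0 < snd c" using Cons.prems(2) by simp
    show "int (size M2) = m - n" using Cons.prems(4) M(1) size1 n by simp
    show "(fst p = 1 \<or> fst p = - 1) \<and> length (snd p) = length t' \<and> (\<forall>x\<in>set (snd p). \<bar>x\<bar> \<le> 1)"
      if "p \<in># M2" for p using that Cons.prems(3)[of p] M(1) lt' by simp
    show "t' ! j + (\<Sum>p\<in>#M2. fst p * snd p ! j) = 0" if "j < length t'" for j
      using that Cons.prems(5)[of j] lq M(1) by (simp add: t'_def sum1)
  qed
  then obtain ds where ds: "ds \<in> set (splits (m - n) t' cs)" "image_mset (\<lambda>p. fst p # snd p) M2 = expand ds"
    "\<forall>c\<in>set ds. 0 < snd c" by blast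
  let ?ds = "put (1 # q) a (put (- 1 # q) (n - a) ds)"
  have "?ds \<in> set (splits m t (c # cs))"
    using bound ds(1) a by (auto simp: q_def n_def t'_def)
  moreover have "image_mset (\<lambda>p. fst p # snd p) M = expand ?ds"
    by (simp add: M(1) PN imP imN ds(2))
  moreover have "\<forall>c\<in>set ?ds. 0 < snd c"
    using ds(3) a by (intro put_pos) simp_all
  ultimately show ?case by blast
qed

lemma residual_nth:
  assumes "\<forall>d\<in>set D. length (tl d) = k" "D \<noteq> []"
  shows "length (residual D) = k" "j < k \<Longrightarrow> residual D ! j = (\<Sum>d\<leftarrow>D. hd d * tl d ! j)"
proof -
  have "length (foldr (\<lambda>d t. map2 (\<lambda>x y. x + hd d * y) t (tl d)) D (replicate k 0)) = k \<and>
      (\<forall>j<k. foldr (\<lambda>d t. map2 (\<lambda>x y. x + hd d * y) t (tl d)) D (replicate k 0) ! j =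
        (\<Sum>d\<leftarrow>D. hd d * tl d ! j))"
    using assms(1) by (induction D) (simp_all add: add.commute)
  moreover have "length (tl (hd D)) = k" using assms by simp
  ultimately show "length (residual D) = k" "j < k \<Longrightarrow> residual D ! j = (\<Sum>d\<leftarrow>D. hd d * tl d ! j)"
    by (simp_all add: residual_def)
qed

lemma same_mset_sound: "same_mset xs ys \<Longrightarrow> mset xs = mset ys"
  by (induction xs ys rule: same_mset.induct) auto

lemma expand_remove_class:
  assumes "i < length cs" "0 < snd (cs ! i)"
  shows "expand cs = add_mset (fst (cs ! i)) (expand (remove_class i cs))"
proof -
  have "nat (snd (cs ! i)) = Suc (nat (snd (cs ! i) - 1))" using assms(2) by linarith
  then have "replicate_mset (nat (snd (cs ! i))) (fst (cs ! i)) =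
      add_mset (fst (cs ! i)) (replicate_mset (nat (snd (cs ! i) - 1)) (fst (cs ! i)))"
    by simp
  moreover have "expand cs = expand (take i cs @ cs ! i # drop (Suc i) cs)"
    using id_take_nth_drop[OF assms(1)] by simp
  ultimately show ?thesis by (simp add: remove_class_def)
qed

lemma remove_class_pos:
  assumes "i < length cs" "\<forall>c\<in>set cs. 0 < snd c"
  shows "\<forall>c\<in>set (remove_class i cs). 0 < snd c"
proof -
  have "0 < snd (cs ! i)" using assms by simp
  then have "\<forall>c\<in>set (put (fst (cs ! i)) (snd (cs ! i) - 1) (drop (Suc i) cs)). 0 < snd c"
    using assms(2) by (intro put_pos) (auto dest: in_set_dropD)
  then show ?thesis using assms(2) by (auto simp: remove_class_def dest: in_set_takeD)
qed

text \<open>Vertices index rows and coordinates alike. \<open>base\<close> is attainable because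
  changing the sign of a row together with the column of the same vertex preserves
  \<open>diag\<close> and \<open>skew\<close>.\<close>

locale normalised_frame =
  fixes R :: "20 \<Rightarrow> 20 \<Rightarrow> int" and C :: "(7 ^ 20) set" and v0 :: 20
  assumes diag: "R v v = 3"
    and skew: "v \<noteq> w \<Longrightarrow> R v w = - R w v"
    and entry: "v \<noteq> w \<Longrightarrow> R v w = 1 \<or> R v w = - 1"
    and orth: "v \<noteq> w \<Longrightarrow> (\<Sum>u\<in>UNIV. R v u * R w u) = 0"
    and base: "w \<noteq> v0 \<Longrightarrow> R v0 w = 1"
    and linear: "linear_code C"
    and row_mem: "(\<chi> w. of_int (R v w)) \<in> C"
    and min_weight: "c \<in> C \<Longrightarrow> c \<noteq> 0 \<Longrightarrow> 9 \<le> hamming_weight c"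
begin

definition col :: "20 list \<Rightarrow> 20 \<Rightarrow> int list" where
  "col vs w = map (\<lambda>v. R v w) vs"

definition realises :: "20 list \<Rightarrow> int list list \<Rightarrow> classes \<Rightarrow> bool" where
  "realises vs D cs \<longleftrightarrow> distinct vs \<and> D = map (col vs) vs \<and>
     image_mset (col vs) (mset_set (- set vs)) = expand cs \<and> (\<forall>c\<in>set cs. 0 < snd c)"

lemma comb_mem: "(\<chi> w. of_int (ldot c (col vs w))) \<in> C"
proof (induction vs arbitrary: c)
  case Nil
  have "(\<chi> w. of_int (ldot c (col [] w))) = (0 :: 7 ^ 20)"
    by (simp add: vec_eq_iff ldot_def col_def)
  then show ?case using linear by (simp add: linear_code_def)
next
  case (Cons v vs)
  show ?case
  proof (cases c)
    case Nil
    then have "(\<chi> w. of_int (ldot c (col (v # vs) w))) = (0 :: 7 ^ 20)"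
      by (simp add: vec_eq_iff ldot_def)
    then show ?thesis using linear by (simp add: linear_code_def)
  next
    case (Cons x c')
    then have "(\<chi> w. of_int (ldot c (col (v # vs) w))) =
        (of_int x :: 7) *s (\<chi> w. of_int (R v w)) + (\<chi> w. of_int (ldot c' (col vs w)))"
      by (simp add: vec_eq_iff ldot_def col_def)
    then show ?thesis using linear row_mem[of v] Cons.IH[of c'] by (simp add: linear_code_def)
  qed
qed

text \<open>A sum over all coordinates whose terms depend only on the column can be computed from
  the search state; weights of combinations are of this kind.\<close>

lemma sum_col:
  fixes h :: "int list \<Rightarrow> int"
  assumes "realises vs D cs"
  shows "(\<Sum>w\<in>UNIV. h (col vs w)) = (\<Sum>d\<leftarrow>D. h d) + (\<Sum>c\<leftarrow>cs. h (fst c) * snd c)"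
proof -
  have r: "distinct vs" "D = map (col vs) vs" "image_mset (col vs) (mset_set (- set vs)) = expand cs"
    "\<forall>c\<in>set cs. 0 < snd c" using assms by (auto simp: realises_def)
  have "(\<Sum>w\<in>UNIV. h (col vs w)) = (\<Sum>w\<in>set vs. h (col vs w)) + (\<Sum>w\<in>- set vs. h (col vs w))"
    by (rule sum_Compl_split)
  also have "(\<Sum>w\<in>set vs. h (col vs w)) = (\<Sum>d\<leftarrow>D. h d)"
    using r(1,2) by (simp add: sum_list_distinct_conv_sum_set o_def)
  also have "(\<Sum>w\<in>- set vs. h (col vs w)) = (\<Sum>q\<in>#image_mset (col vs) (mset_set (- set vs)). h q)"
    by (simp add: sum_unfold_sum_mset image_mset.compositionality o_def)
  also have "\<dots> = (\<Sum>c\<leftarrow>cs. h (fst c) * snd c)"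
    unfolding r(3) using r(4) by (rule sum_expand)
  finally show ?thesis .
qed

lemma no_low_comb:
  assumes "realises vs D cs" "0 < comb_weight c D cs"
  shows "9 \<le> comb_weight c D cs"
proof -
  define y :: "7 ^ 20" where "y = (\<chi> w. of_int (ldot c (col vs w)))"
  have "int (hamming_weight y) = (\<Sum>w\<in>UNIV. if y $ w = 0 then 0 else 1)"
    by (simp add: hamming_weight_def sum.If_cases Collect_neg_eq)
  also have "\<dots> = (\<Sum>w\<in>UNIV. (\<lambda>d. if ldot c d mod 7 = 0 then 0 else 1) (col vs w))"
    by (simp add: y_def of_int_7_eq_0_iff dvd_eq_mod_eq_0)
  also have "\<dots> = comb_weight c D cs"
    unfolding sum_col[OF assms(1), of "\<lambda>d. if ldot c d mod 7 = 0 then 0 else 1"] comb_weight_def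
    by (intro arg_cong2[where f = "(+)"] arg_cong[where f = sum_list] map_cong) auto
  finally have w: "int (hamming_weight y) = comb_weight c D cs" .
  with assms(2) have "y \<noteq> 0" by (auto simp: hamming_weight_def)
  moreover have "y \<in> C" unfolding y_def by (rule comb_mem)
  ultimately have "9 \<le> hamming_weight y" by (intro min_weight)
  with w show ?thesis by linarith
qed

text \<open>A class of positive multiplicity contains some vertex v. Skewness fixes row v on the
  chosen vertices; orthogonality to the older rows, divided into chosen and remaining coordinates,
  is the equation that \<open>splits\<close> solves from \<open>residual\<close>.\<close>

lemma realises_extend:
  assumes re: "realises vs D cs" and i: "i < length cs"
  defines "E \<equiv> new_columns (fst (cs ! i)) D" and "rs \<equiv> remove_class i cs"
  shows "\<exists>v. \<exists>ds\<in>set (splits (sum_list (map snd rs)) (residual E) rs). realises (v # vs) E ds"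
proof -
  define q where "q = fst (cs ! i)"
  have r: "distinct vs" "D = map (col vs) vs" "image_mset (col vs) (mset_set (- set vs)) = expand cs"
    "\<forall>c\<in>set cs. 0 < snd c" using re by (auto simp: realises_def)
  have ci: "0 < snd (cs ! i)" using r(4) i by simp
  have ex: "expand cs = add_mset q (expand rs)"
    unfolding q_def rs_def by (rule expand_remove_class[OF i ci])
  then have "q \<in># image_mset (col vs) (mset_set (- set vs))" using r(3) by simp
  then obtain v where v: "v \<notin> set vs" "col vs v = q" by auto
  let ?W = "- set (v # vs)"
  have "- set vs = insert v ?W" using v(1) by auto
  then have "mset_set (- set vs) = add_mset v (mset_set ?W)" by simp
  then have W: "image_mset (col vs) (mset_set ?W) = expand rs"
    using r(3) ex v(2) by simp
  have E: "E = map (col (v # vs)) (v # vs)"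
  proof -
    have "R v u = - R u v" if "u \<in> set vs" for u
      by (rule skew) (use that v(1) in auto)
    then have "map2 (\<lambda>d x. - x # d) (map (col vs) vs) (map (\<lambda>u. R u v) vs) = map (col (v # vs)) vs"
      by (simp add: map2_map_map col_def)
    then show ?thesis
      using v(2) by (simp add: E_def new_columns_def r(2) col_def diag flip: q_def)
  qed
  have d': "distinct (v # vs)" using r(1) v(1) by simp
  define M where "M = image_mset (\<lambda>w. (R v w, col vs w)) (mset_set ?W)"
  have Ek: "\<forall>d\<in>set E. length (tl d) = length vs" "E \<noteq> []" by (auto simp: E col_def)
  have pos: "\<forall>c\<in>set rs. 0 < snd c" unfolding rs_def by (rule remove_class_pos[OF i r(4)])
  have "\<exists>ds\<in>set (splits (sum_list (map snd rs)) (residual E) rs).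
      image_mset (\<lambda>p. fst p # snd p) M = expand ds \<and> (\<forall>c\<in>set ds. 0 < snd c)"
  proof (rule splits_complete)
    show M: "image_mset snd M = expand rs"
      using W by (simp add: M_def image_mset.compositionality o_def)
    show "\<forall>c\<in>set rs. 0 < snd c" by (rule pos)
    show "int (size M) = sum_list (map snd rs)"
      using size_expand[OF pos] by (metis M size_image_mset)
    show "(fst p = 1 \<or> fst p = - 1) \<and> length (snd p) = length (residual E) \<and> (\<forall>x\<in>set (snd p). \<bar>x\<bar> \<le> 1)"
      if "p \<in># M" for p
    proof -
      have "p \<in> (\<lambda>w. (R v w, col vs w)) ` ?W" using that by (simp add: M_def)
      then obtain w where w: "w \<notin> set (v # vs)" "p = (R v w, col vs w)" by blast
      have "\<bar>R u w\<bar> \<le> 1" if "u \<in> set vs" for u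
        using entry[of u w] that w(1) by force
      then show ?thesis
        using entry[of v w] w residual_nth(1)[OF Ek] by (auto simp: col_def)
    qed
    show "residual E ! j + (\<Sum>p\<in>#M. fst p * snd p ! j) = 0" if "j < length (residual E)" for j
    proof -
      have j: "j < length vs" using that residual_nth(1)[OF Ek] by simp
      define u where "u = vs ! j"
      have "v \<noteq> u" using v(1) j by (auto simp: u_def)
      have "residual E ! j = (\<Sum>d\<leftarrow>E. hd d * tl d ! j)" by (rule residual_nth(2)[OF Ek j])
      also have "\<dots> = (\<Sum>w\<leftarrow>v # vs. R v w * R u w)"
        unfolding E map_map using j
        by (intro arg_cong[where f = sum_list] map_cong) (simp_all add: col_def u_def)
      also have "\<dots> = (\<Sum>w\<in>set (v # vs). R v w * R u w)"
        by (rule sum_list_distinct_conv_sum_set[OF d'])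
      finally have 1: "residual E ! j = (\<Sum>w\<in>set (v # vs). R v w * R u w)" .
      have "(\<Sum>p\<in>#M. fst p * snd p ! j) = (\<Sum>w\<in>?W. R v w * R u w)"
        using j by (simp add: M_def image_mset.compositionality o_def sum_unfold_sum_mset col_def u_def)
      moreover have "(\<Sum>w\<in>UNIV. R v w * R u w) =
          (\<Sum>w\<in>set (v # vs). R v w * R u w) + (\<Sum>w\<in>?W. R v w * R u w)"
        by (rule sum_Compl_split)
      ultimately show ?thesis using orth[OF \<open>v \<noteq> u\<close>] 1 by linarith
    qed
  qed
  then obtain ds where ds: "ds \<in> set (splits (sum_list (map snd rs)) (residual E) rs)"
    "image_mset (\<lambda>p. fst p # snd p) M = expand ds" "\<forall>c\<in>set ds. 0 < snd c" by blast
  have "col (v # vs) = (\<lambda>w. R v w # col vs w)" by (simp add: fun_eq_iff col_def)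
  then have "image_mset (col (v # vs)) (mset_set ?W) = expand ds"
    unfolding ds(2)[symmetric] M_def by (simp add: image_mset.compositionality o_def)
  then have "realises (v # vs) E ds" using d' E ds(3) by (simp add: realises_def)
  with ds(1) show ?thesis by blast
qed

text \<open>Low combinations contradict the minimum weight and branches follow an actual vertex, so
  some leaf is reached. There the columns of the frame rows and of the Paley rows form the same
  multiset, hence differ by a permutation of the coordinates.\<close>

lemma check_sound:
  assumes "check D cs t" "realises vs D cs"
  shows "\<exists>\<tau> vs ps co. \<tau> permutes UNIV \<and> length vs = length ps \<and> (\<forall>p\<in>set ps. p < 20) \<and>
     (\<forall>i<length ps. \<forall>w. R (vs ! i) w = paley ! (ps ! i) ! ix (\<tau> w)) \<and>
     spans co (map (\<lambda>p. paley ! p) ps) left_basis"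
  using assms
proof (induction t arbitrary: vs D cs)
  case (Low c)
  then show ?case using no_low_comb[OF Low(2), of c] by (simp add: Let_def)
next
  case (Branch i ts)
  define E rs where "E = new_columns (fst (cs ! i)) D" and "rs = remove_class i cs"
  have i: "i < length cs"
    and l: "list_all2 (check E) (splits (sum_list (map snd rs)) (residual E) rs) ts"
    using Branch.prems(1) by (simp_all add: Let_def E_def rs_def)
  obtain v ds where ds: "ds \<in> set (splits (sum_list (map snd rs)) (residual E) rs)" "realises (v # vs) E ds"
    using realises_extend[OF Branch.prems(2) i] unfolding E_def rs_def by blast
  obtain t where "t \<in> set ts" "check E ds t"
    using l ds(1) by (metis in_set_conv_nth list_all2_conv_all_nth)
  then show ?case using Branch.IH ds(2) by blast
next
  case (Leaf ps co)
  have r: "distinct vs" "D = map (col vs) vs" "image_mset (col vs) (mset_set (- set vs)) = expand cs"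
    using Leaf.prems(2) by (auto simp: realises_def)
  have k: "\<forall>p\<in>set ps. p < 20" "spans co (map (\<lambda>p. paley ! p) ps) left_basis" "length ps = length (hd D)"
    and s: "same_mset (D @ concat (map (\<lambda>c. replicate (nat (snd c)) (fst c)) cs))
      (map (\<lambda>j. map (\<lambda>p. paley ! p ! j) ps) [0..<20])"
    using Leaf.prems(1) by (simp_all del: upt_rec_numeral)
  have m: "mset (D @ concat (map (\<lambda>c. replicate (nat (snd c)) (fst c)) cs)) =
      mset (map (\<lambda>j. map (\<lambda>p. paley ! p ! j) ps) [0..<20])"
    by (rule same_mset_sound[OF s])
  let ?g = "\<lambda>w. map (\<lambda>p. paley ! p ! ix w) ps"
  have "mset (concat (map (\<lambda>c. replicate (nat (snd c)) (fst c)) cs)) = expand cs"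
    by (induction cs) simp_all
  moreover have "mset D = image_mset (col vs) (mset_set (set vs))"
    using r(1,2) by (simp add: mset_set_set)
  ultimately have "image_mset (col vs) (mset_set (set vs) + mset_set (- set vs)) =
      mset (map (\<lambda>j. map (\<lambda>p. paley ! p ! j) ps) [0..<20])"
    using m r(3) by simp
  also have "mset_set (set vs) + mset_set (- set vs) = mset_set UNIV"
    using mset_set_Union[of "set vs" "- set vs"] by (simp add: Compl_partition)
  also have "mset (map (\<lambda>j. map (\<lambda>p. paley ! p ! j) ps) [0..<20]) =
      image_mset (\<lambda>j. map (\<lambda>p. paley ! p ! j) ps) (mset_set {..<20})"
    by (simp add: atLeast0LessThan del: upt_rec_numeral)
  also have "\<dots> = image_mset (\<lambda>j. ?g (of_nat j)) (mset_set {..<20})"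
    by (intro image_mset_cong) simp
  also have "\<dots> = image_mset ?g (image_mset of_nat (mset_set {..<20}))"
    by (simp add: image_mset.compositionality o_def)
  also have "image_mset of_nat (mset_set {..<20}) = (mset_set UNIV :: 20 multiset)"
    using bij_of_nat20 by (simp add: image_mset_mset_set bij_betw_def)
  finally obtain \<tau> where \<tau>: "\<tau> permutes UNIV" "\<forall>w\<in>UNIV. col vs w = ?g (\<tau> w)"
    by (rule image_mset_eq_implies_permutes[OF finite])
  have len: "length vs = length ps" using \<tau>(2) by (metis UNIV_I col_def length_map)
  have "R (vs ! i) w = paley ! (ps ! i) ! ix (\<tau> w)" if "i < length ps" for i w
  proof -
    have "col vs w ! i = ?g (\<tau> w) ! i" using \<tau>(2) by simp
    then show ?thesis using that len by (simp add: col_def)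
  qed
  then show ?case using \<tau>(1) len k(1,2) by blast
qed

lemma realises_start: "realises [v0] [[3]] [([1], 19)]"
proof -
  have "image_mset (col [v0]) (mset_set (- {v0})) = image_mset (\<lambda>_. [1]) (mset_set (- {v0}))"
    by (intro image_mset_cong) (simp add: col_def base)
  moreover have "card (- {v0}) = 19" by (simp add: Compl_eq_Diff_UNIV)
  ultimately show ?thesis by (simp add: realises_def col_def diag image_mset_const_eq)
qed

text \<open>The matched Paley rows span \<open>QR20\<close> and lie in the permuted code, which has
  at most 7^10 words; inclusion becomes equality.\<close>

lemma permuted_QR20:
  assumes "card C = 7 ^ 10"
  shows "\<exists>\<tau>. \<tau> permutes UNIV \<and> QR20 = {y. (\<chi> w. y $ \<tau> w) \<in> C}"
proof -
  obtain \<tau> vs ps co where \<tau>: "\<tau> permutes UNIV" and len: "length vs = length ps"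
    and ps: "\<forall>p\<in>set ps. p < 20"
    and R: "\<forall>i<length ps. \<forall>w. R (vs ! i) w = paley ! (ps ! i) ! ix (\<tau> w)"
    and co: "spans co (map (\<lambda>p. paley ! p) ps) left_basis"
    using check_sound[OF check_search_cert realises_start] by blast
  define C' where "C' = {y :: 7 ^ 20. (\<chi> w. y $ \<tau> w) \<in> C}"
  have lin: "linear_code C'"
    unfolding linear_code_def
  proof (intro conjI ballI allI impI)
    have "(\<chi> w. (0 :: 7 ^ 20) $ \<tau> w) = 0" by (simp add: vec_eq_iff)
    then show "0 \<in> C'" using linear by (simp add: C'_def linear_code_def)
  next
    fix x y assume "x \<in> C'" "y \<in> C'"
    moreover have "(\<chi> w. (x + y) $ \<tau> w) = (\<chi> w. x $ \<tau> w) + (\<chi> w. y $ \<tau> w)" by (simp add: vec_eq_iff)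
    ultimately show "x + y \<in> C'" using linear by (simp add: C'_def linear_code_def)
  next
    fix a x assume "x \<in> C'"
    moreover have "(\<chi> w. (a *s x) $ \<tau> w) = a *s (\<chi> w. x $ \<tau> w)" by (simp add: vec_eq_iff)
    ultimately show "a *s x \<in> C'" using linear by (simp add: C'_def linear_code_def)
  qed
  have "length r = 20 \<and> gf_vec r \<in> C'" if r: "r \<in> set (map (\<lambda>p. paley ! p) ps)" for r
  proof -
    obtain i where i: "i < length ps" "r = paley ! (ps ! i)"
      using r by (auto simp: in_set_conv_nth)
    have "(\<chi> w. gf_vec r $ \<tau> w) = (\<chi> w. of_int (R (vs ! i) w))"
      using R i by (simp add: vec_eq_iff)
    then have "gf_vec r \<in> C'" using row_mem by (simp add: C'_def)
    moreover have "r \<in> set paley" using i ps by (simp add: lengths_20)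
    ultimately show ?thesis by (simp add: lengths_20)
  qed
  then have "\<forall>r\<in>set left_basis. gf_vec r \<in> C'"
    using spans_mem[OF co lin] by blast
  then have sub: "QR20 \<subseteq> C'" by (intro QR20_subset lin)
  have "inj_on (\<lambda>y :: 7 ^ 20. \<chi> w. y $ \<tau> w) C'"
  proof (rule inj_onI)
    fix x y :: "7 ^ 20" assume "(\<chi> w. x $ \<tau> w) = (\<chi> w. y $ \<tau> w)"
    then have "x $ \<tau> w = y $ \<tau> w" for w by (simp add: vec_eq_iff)
    then show "x = y" using \<tau> by (metis permutes_univ vec_eq_iff)
  qed
  then have "card C' \<le> card C"
    by (intro card_inj_on_le[where f = "\<lambda>y. \<chi> w. y $ \<tau> w"]) (auto simp: C'_def)
  then have "QR20 = C'"
    using sub card_QR20 assms by (intro card_seteq) simp_all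
  then show ?thesis using \<tau> unfolding C'_def by blast
qed

end

section \<open>Frames of \<open>D\<^sub>2\<^sub>0\<^sup>+\<close>\<close>

lemma even_half_sum: "s = 20 * e + 2 * t \<Longrightarrow> 4 dvd s \<Longrightarrow> even t" for s t e :: int
  by presburger

lemma mod_8_times_7: "8 * x mod 7 = x mod (7 :: int)"
  by (simp add: mod_eq_dvd_iff)

text \<open>In terms of z = 2 y both cosets obey the same condition: z = 2 a + k has sum 2 (sum of
  a) + 20 k, and 20 is divisible by 4.\<close>

lemma D_plus_lattice_iff:
  "y \<in> (D_plus_lattice :: (real ^ 20) set) \<longleftrightarrow>
    (\<exists>z :: 20 \<Rightarrow> int. (\<exists>e. \<forall>i. z i mod 2 = e) \<and> 4 dvd (\<Sum>i\<in>UNIV. z i) \<and> (\<forall>i. y $ i = of_int (z i) / 2))"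
  (is "_ \<longleftrightarrow> ?R")
proof
  assume "y \<in> D_plus_lattice"
  then obtain a :: "int ^ 20" and k where a: "even (\<Sum>i\<in>UNIV. a $ i)"
    and y: "y = (\<chi> i. real_of_int (a $ i)) + real_of_int k *\<^sub>R (\<chi> i. 1 / 2)"
    by (auto simp: D_plus_lattice_def D_lattice_def)
  define z where "z i = 2 * a $ i + k" for i
  obtain b where b: "(\<Sum>i\<in>UNIV. a $ i) = 2 * b" using a by (rule dvdE)
  have "(\<Sum>i\<in>UNIV. z i) = 4 * (b + 5 * k)"
    by (simp add: z_def sum.distrib b flip: sum_distrib_left)
  moreover have "z i mod 2 = k mod 2" for i by (simp add: z_def)
  moreover have "y $ i = of_int (z i) / 2" for i by (simp add: y z_def field_simps)
  ultimately show ?R by (metis dvd_triv_left)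
next
  assume ?R
  then obtain z e where z: "\<And>i. z i mod 2 = e" "4 dvd (\<Sum>i\<in>UNIV. z i)" "\<And>i. y $ i = of_int (z i) / 2"
    by blast
  define a :: "int ^ 20" where "a = (\<chi> i. z i div 2)"
  have za: "z i = 2 * a $ i + e" for i using z(1)[of i] by (simp add: a_def flip: z(1)[of i])
  have "(\<Sum>i\<in>UNIV. z i) = 20 * e + 2 * (\<Sum>i\<in>UNIV. a $ i)"
    by (simp add: za sum.distrib flip: sum_distrib_left)
  then have "even (\<Sum>i\<in>UNIV. a $ i)" using z(2) by (rule even_half_sum)
  then have "(\<chi> i. real_of_int (a $ i)) \<in> D_lattice" unfolding D_lattice_def by blast
  moreover have "y = (\<chi> i. real_of_int (a $ i)) + real_of_int e *\<^sub>R (\<chi> i. 1 / 2)"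
    by (simp add: vec_eq_iff z(3) za field_simps)
  ultimately show "y \<in> D_plus_lattice" unfolding D_plus_lattice_def by blast
qed

lemma constructionA_7_iff:
  fixes C :: "(7 ^ 20) set"
  shows "v \<in> constructionA 7 C \<longleftrightarrow>
    (\<exists>x :: 20 \<Rightarrow> int. (\<chi> i. of_int (x i)) \<in> C \<and> (\<forall>i. v $ i = sqrt 7 / 7 * of_int (x i)))"
proof
  assume "v \<in> constructionA 7 C"
  then obtain x :: "int ^ 20" where "(\<chi> i. (of_int (x $ i) :: 7)) \<in> C"
    "v = (1 / real 7) *\<^sub>R (\<chi> i. sqrt (real 7) * real_of_int (x $ i))"
    by (auto simp: constructionA_def)
  then show "\<exists>x :: 20 \<Rightarrow> int. (\<chi> i. of_int (x i)) \<in> C \<and> (\<forall>i. v $ i = sqrt 7 / 7 * of_int (x i))"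
    by (intro exI[of _ "\<lambda>i. x $ i"]) simp
next
  assume "\<exists>x :: 20 \<Rightarrow> int. (\<chi> i. of_int (x i)) \<in> C \<and> (\<forall>i. v $ i = sqrt 7 / 7 * of_int (x i))"
  then obtain x :: "20 \<Rightarrow> int" where x: "(\<chi> i. of_int (x i)) \<in> C" "\<forall>i. v $ i = sqrt 7 / 7 * of_int (x i)"
    by blast
  define x' :: "int ^ 20" where "x' = (\<chi> i. x i)"
  have "v = (1 / real 7) *\<^sub>R (\<chi> i. sqrt (real 7) * real_of_int (x' $ i))"
    using x(2) by (simp add: vec_eq_iff x'_def)
  moreover have "(\<chi> i. (of_int (x' $ i) :: 7)) \<in> C" using x(1) by (simp add: x'_def)
  ultimately show "v \<in> constructionA 7 C" unfolding constructionA_def by blast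
qed

section \<open>The isometry given by the Paley matrix\<close>

definition pal :: "20 \<Rightarrow> 20 \<Rightarrow> int" where
  "pal v w = paley ! ix v ! ix w"

lemma pal_odd: "odd (pal v w)"
proof -
  have "\<forall>r\<in>set paley. \<forall>x\<in>set r. x mod 2 = 1" by code_simp
  moreover have "paley ! ix v \<in> set paley" "paley ! ix v ! ix w \<in> set (paley ! ix v)"
    using lengths_20 by simp_all
  ultimately have "pal v w mod 2 = 1" unfolding pal_def by blast
  then show ?thesis by presburger
qed

lemma pal_orth:
  "(\<Sum>w\<in>UNIV. pal u w * pal v w) = (if u = v then 28 else 0)"
  "(\<Sum>w\<in>UNIV. pal w u * pal w v) = (if u = v then 28 else 0)"
proof -
  have o: "\<forall>i\<in>set [0..<20]. \<forall>j\<in>set [0..<20].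
      ldot (paley ! i) (paley ! j) = (if i = j then 28 else 0) \<and>
      ldot (map (\<lambda>r. r ! i) paley) (map (\<lambda>r. r ! j) paley) = (if i = j then 28 else 0)"
    by code_simp
  have uv: "ix u \<in> set [0..<20]" "ix v \<in> set [0..<20]" by simp_all
  have ixe: "ix u = ix v \<longleftrightarrow> u = v" by (metis of_nat_ix)
  have ld: "ldot xs ys = (\<Sum>w\<in>UNIV. xs ! ix w * ys ! ix w)" if "length xs = 20" "length ys = 20" for xs ys
    using that by (simp add: sum_20 ldot_def sum_list_sum_nth atLeast0LessThan)
  show "(\<Sum>w\<in>UNIV. pal u w * pal v w) = (if u = v then 28 else 0)"
    using o uv ld[of "paley ! ix u" "paley ! ix v"] ixe by (simp add: pal_def lengths_20 del: set_upt)
  show "(\<Sum>w\<in>UNIV. pal w u * pal w v) = (if u = v then 28 else 0)"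
    using o uv ld[of "map (\<lambda>r. r ! ix u) paley" "map (\<lambda>r. r ! ix v) paley"] ixe
    by (simp add: pal_def lengths_20 del: set_upt)
qed

lemma pal_column_sum: "4 dvd (\<Sum>v\<in>UNIV. pal v w)"
proof -
  have "\<forall>i\<in>set [0..<20]. sum_list (map (\<lambda>r. r ! i) paley) mod 4 = 0" by code_simp
  moreover have "ix w \<in> set [0..<20]" by simp
  ultimately have "sum_list (map (\<lambda>r. r ! ix w) paley) mod 4 = 0" by blast
  moreover have "sum_list (map (\<lambda>r. r ! ix w) paley) = (\<Sum>v\<in>UNIV. pal v w)"
    by (simp add: sum_20 pal_def sum_list_sum_nth atLeast0LessThan lengths_20)
  ultimately show ?thesis by (simp add: dvd_eq_mod_eq_0)
qed

lemma pal_mem: "(\<chi> w. of_int (pal v w)) \<in> QR20"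
proof -
  have "(\<chi> w. of_int (pal v w)) = gf_vec (paley ! ix v)" by (simp add: vec_eq_iff pal_def)
  then show ?thesis by (simp add: gf_vec_basis lengths_20)
qed

lemma sum_mod_2_odd:
  fixes f g :: "'a \<Rightarrow> int"
  assumes "\<And>i. i \<in> A \<Longrightarrow> odd (g i)"
  shows "(\<Sum>i\<in>A. f i * g i) mod 2 = (\<Sum>i\<in>A. f i) mod 2"
proof -
  have "(f i * g i) mod 2 = f i mod 2" if i: "i \<in> A" for i
  proof -
    obtain k where "g i = 2 * k + 1" using assms[OF i] by (rule oddE)
    then have "f i * g i = f i + 2 * (f i * k)" by (simp add: algebra_simps)
    then show ?thesis by simp
  qed
  then have "(\<Sum>i\<in>A. (f i * g i) mod 2) = (\<Sum>i\<in>A. f i mod 2)" by (intro sum.cong) simp_all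
  then show ?thesis
    using mod_sum_eq[of "\<lambda>i. f i * g i" 2 A] mod_sum_eq[of f 2 A] by simp
qed

lemma lattice_iso_QR20: "lattice_iso (constructionA 7 QR20) (D_plus_lattice :: (real ^ 20) set)"
proof -
  define A :: "real ^ 20 ^ 20" where "A = (\<chi> i j. of_int (pal j i) / (2 * sqrt 7))"
  have "(\<Sum>k\<in>UNIV. A $ k $ i * A $ k $ j) = (if i = j then 1 else 0)" for i j
  proof -
    have "(\<Sum>k\<in>UNIV. A $ k $ i * A $ k $ j) = (\<Sum>k\<in>UNIV. of_int (pal i k * pal j k) / 28)"
      by (intro sum.cong) (simp_all add: A_def)
    also have "\<dots> = of_int (\<Sum>k\<in>UNIV. pal i k * pal j k) / 28"
      by (simp add: sum_divide_distrib)
    also have "\<dots> = (if i = j then 1 else 0)" unfolding pal_orth by simp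
    finally show ?thesis .
  qed
  then have "orthogonal_matrix A"
    by (simp add: orthogonal_matrix vec_eq_iff matrix_matrix_mult_def transpose_def mat_def)
  moreover have mult: "(v v* A) $ j = of_int (\<Sum>i\<in>UNIV. x i * pal j i) / 14"
    if "\<forall>i. v $ i = sqrt 7 / 7 * of_int (x i)" for v :: "real ^ 20" and x :: "20 \<Rightarrow> int" and j
  proof -
    have "sqrt 7 / 7 * b * (a / (2 * sqrt 7)) = b * a / 14" for a b :: real
      by (simp add: field_simps)
    then have "(v v* A) $ j = (\<Sum>i\<in>UNIV. of_int (x i * pal j i) / 14)"
      by (simp only: vector_matrix_mult_def A_def vec_lambda_beta spec[OF that] of_int_mult)
    then show ?thesis by (simp add: sum_divide_distrib)
  qed
  have "D_plus_lattice = (\<lambda>v. v v* A) ` constructionA 7 QR20"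
  proof (intro equalityI subsetI)
    fix y assume "y \<in> (\<lambda>v. v v* A) ` constructionA 7 QR20"
    then obtain v x where y: "y = v v* A" and xC: "(\<chi> i. (of_int (x i) :: 7)) \<in> QR20"
      and v: "\<forall>i. v $ i = sqrt 7 / 7 * of_int (x i)"
      by (auto simp: constructionA_7_iff)
    \<comment> \<open>Both factors are words of a self-orthogonal code. Dividing by 7 leaves z; its
      common parity comes from the odd entries and the divisibility of its sum by 4 from the column
      sums.\<close>
    have "7 dvd (\<Sum>i\<in>UNIV. x i * pal j i)" for j
    proof -
      have "dot (\<chi> i. (of_int (x i) :: 7)) (\<chi> i. of_int (pal j i)) = 0"
        using xC pal_mem[of j] QR20_self_orthogonal by (auto simp: dual_code_def)
      then have "of_int (\<Sum>i\<in>UNIV. x i * pal j i) = (0 :: 7)" by (simp add: dot_def)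
      then show ?thesis by (simp only: of_int_7_eq_0_iff)
    qed
    then obtain z where z: "\<And>j. (\<Sum>i\<in>UNIV. x i * pal j i) = 7 * z j" unfolding dvd_def by metis
    have "z j mod 2 = (\<Sum>i\<in>UNIV. x i) mod 2" for j
    proof -
      have "(7 * z j) mod 2 = (\<Sum>i\<in>UNIV. x i) mod 2"
        unfolding z[symmetric] by (rule sum_mod_2_odd) (rule pal_odd)
      then show ?thesis by presburger
    qed
    moreover have "4 dvd (\<Sum>j\<in>UNIV. z j)"
    proof -
      have "7 * (\<Sum>j\<in>UNIV. z j) = (\<Sum>j\<in>UNIV. \<Sum>i\<in>UNIV. x i * pal j i)"
        by (simp add: z sum_distrib_left)
      also have "\<dots> = (\<Sum>i\<in>UNIV. x i * (\<Sum>j\<in>UNIV. pal j i))"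
        unfolding sum_distrib_left by (rule sum.swap)
      finally have "4 dvd 7 * (\<Sum>j\<in>UNIV. z j)" by (simp add: dvd_sum pal_column_sum)
      then show ?thesis by presburger
    qed
    moreover have "y $ j = of_int (z j) / 2" for j by (simp add: y mult[OF v] z)
    ultimately show "y \<in> D_plus_lattice" unfolding D_plus_lattice_iff by blast
  next
    fix y :: "real ^ 20" assume "y \<in> D_plus_lattice"
    then obtain z e where z: "\<And>i. z i mod 2 = e" "4 dvd (\<Sum>i\<in>UNIV. z i)" "\<And>i. y $ i = of_int (z i) / 2"
      unfolding D_plus_lattice_iff by blast
    define b where "b i = z i div 2" for i
    have zb: "z i = e + 2 * b i" for i by (simp add: b_def flip: z(1)[of i])
    have "(\<Sum>i\<in>UNIV. z i) = 20 * e + 2 * (\<Sum>i\<in>UNIV. b i)"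
      by (simp add: zb sum.distrib flip: sum_distrib_left)
    then have "even (\<Sum>i\<in>UNIV. b i)" using z(2) by (rule even_half_sum)
    then have ev: "(\<Sum>i\<in>UNIV. b i) mod 2 = 0" by (simp only: dvd_eq_mod_eq_0)
    \<comment> \<open>With z = e + 2 b the part of e is handled by the column sum. In the part of b,
      odd entries preserve the parity of the sum of b, which is even.\<close>
    have "4 dvd (\<Sum>j\<in>UNIV. z j * pal j i)" for i
    proof -
      have "(\<Sum>j\<in>UNIV. b j * pal j i) mod 2 = (\<Sum>j\<in>UNIV. b j) mod 2"
        by (rule sum_mod_2_odd) (rule pal_odd)
      then obtain c where c: "(\<Sum>j\<in>UNIV. b j * pal j i) = 2 * c" using ev by (auto elim: evenE)
      have "(\<Sum>j\<in>UNIV. z j * pal j i) = e * (\<Sum>j\<in>UNIV. pal j i) + 2 * (\<Sum>j\<in>UNIV. b j * pal j i)"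
        by (simp add: zb distrib_right sum.distrib sum_distrib_left mult.assoc)
      then show ?thesis using pal_column_sum[of i] by (simp add: c)
    qed
    then obtain x where x: "\<And>i. (\<Sum>j\<in>UNIV. z j * pal j i) = 4 * x i" unfolding dvd_def by metis
    \<comment> \<open>2 inverts 4 modulo 7, so x is congruent to the combination of Paley rows with
      coefficients 2 z_j.\<close>
    have "(of_int (x i) :: 7) = (\<Sum>j\<in>UNIV. of_int (2 * z j) * of_int (pal j i))" for i
    proof -
      have "(\<Sum>j\<in>UNIV. of_int (2 * z j) * of_int (pal j i)) = (of_int (2 * (\<Sum>j\<in>UNIV. z j * pal j i)) :: 7)"
        by (simp add: sum_distrib_left mult.assoc)
      also have "\<dots> = of_int (8 * x i)" by (simp only: x) simp
      also have "\<dots> = of_int (x i)" unfolding of_int_7_eq_iff by (rule mod_8_times_7)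
      finally show ?thesis by simp
    qed
    then have "(\<chi> i. (of_int (x i) :: 7)) = (\<Sum>j\<in>UNIV. of_int (2 * z j) *s (\<chi> i. of_int (pal j i)))"
      by (simp add: vec_eq_iff)
    also have "\<dots> \<in> QR20" by (intro linear_code_sum linear_QR20 pal_mem)
    finally have xC: "(\<chi> i. (of_int (x i) :: 7)) \<in> QR20" .
    define v :: "real ^ 20" where "v = (\<chi> i. sqrt 7 / 7 * of_int (x i))"
    have v: "\<forall>i. v $ i = sqrt 7 / 7 * of_int (x i)" by (simp add: v_def)
    have "4 * (\<Sum>i\<in>UNIV. x i * pal j i) = 4 * (7 * z j)" for j
    proof -
      have "4 * (\<Sum>i\<in>UNIV. x i * pal j i) = (\<Sum>i\<in>UNIV. (\<Sum>k\<in>UNIV. z k * pal k i) * pal j i)"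
        by (simp add: x sum_distrib_left mult.assoc)
      also have "\<dots> = (\<Sum>k\<in>UNIV. z k * (\<Sum>i\<in>UNIV. pal k i * pal j i))"
        unfolding sum_distrib_left sum_distrib_right mult.assoc by (rule sum.swap)
      finally show ?thesis by (simp add: pal_orth if_distrib[of "(*) _"] cong: if_cong)
    qed
    then have "(\<Sum>i\<in>UNIV. x i * pal j i) = 7 * z j" for j by simp
    then have "y = v v* A" by (simp add: vec_eq_iff mult[OF v] z(3))
    moreover have "v \<in> constructionA 7 QR20" unfolding constructionA_7_iff using v xC by blast
    ultimately show "y \<in> (\<lambda>v. v v* A) ` constructionA 7 QR20" by blast
  qed
  ultimately show ?thesis unfolding lattice_iso_def by blast
qed

text \<open>Odd squares are 1 modulo 8, and 28 = 20 + 8: exactly one of the twenty squares is 9, the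
  others are 1.\<close>

lemma odd_norm_28:
  fixes f :: "20 \<Rightarrow> int"
  assumes "\<And>i. odd (f i)" "(\<Sum>i\<in>UNIV. f i * f i) = 28"
  shows "\<exists>i. \<bar>f i\<bar> = 3 \<and> (\<forall>j. j \<noteq> i \<longrightarrow> \<bar>f j\<bar> = 1)"
proof -
  define g where "g i = nat ((f i * f i - 1) div 8)" for i
  have g: "f i * f i = 1 + 8 * int (g i)" for i
  proof -
    obtain k where k: "f i = 2 * k + 1" using assms(1)[of i] by (rule oddE)
    have "even (k * (k + 1))" by simp
    then obtain l where l: "k * (k + 1) = 2 * l" by (rule evenE)
    have "f i * f i = 4 * (k * (k + 1)) + 1" by (simp add: k algebra_simps)
    then have "f i * f i - 1 = 8 * l" using l by simp
    moreover have "0 \<le> l"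
    proof -
      have "0 \<le> f i * f i" by simp
      with \<open>f i * f i - 1 = 8 * l\<close> show ?thesis by linarith
    qed
    ultimately show ?thesis by (simp add: g_def)
  qed
  have "int (\<Sum>i\<in>UNIV. g i) * 8 + 20 = 28"
    using assms(2) by (simp add: g sum.distrib sum_distrib_right flip: sum_distrib_left)
  then have "(\<Sum>i\<in>UNIV. g i) = 1" by (simp flip: of_nat_sum)
  then obtain i where i: "g i = 1" "\<And>j. i \<noteq> j \<Longrightarrow> g j = 0"
    unfolding sum_eq_1_iff[OF finite] by blast
  have "\<bar>f i\<bar> = 3"
  proof -
    have "\<bar>f i\<bar>\<^sup>2 = 3\<^sup>2" using g[of i] i(1) by (simp add: power2_eq_square)
    then show ?thesis by (rule power2_eq_imp_eq) simp_all
  qed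
  moreover have "\<bar>f j\<bar> = 1" if "j \<noteq> i" for j
  proof -
    have "\<bar>f j\<bar>\<^sup>2 = 1\<^sup>2" using g[of j] i(2)[of j] that by (simp add: power2_eq_square)
    then show ?thesis by (rule power2_eq_imp_eq) simp_all
  qed
  ultimately show ?thesis by blast
qed

text \<open>A vector of norm 7 in \<open>D\<^sub>2\<^sub>0\<^sup>+\<close> lies in the nontrivial coset of \<open>D\<^sub>2\<^sub>0\<close>, since \<open>D\<^sub>2\<^sub>0\<close> is even.\<close>
lemma D_plus_norm_7_odd:
  fixes z :: "20 \<Rightarrow> int"
  assumes "\<forall>i. z i mod 2 = e" "4 dvd (\<Sum>i\<in>UNIV. z i)" "(\<Sum>i\<in>UNIV. z i * z i) = 28"
  shows "odd (z i)"
proof (rule ccontr)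
  assume "\<not> odd (z i)"
  then have "e = 0" using assms(1) by (metis even_iff_mod_2_eq_zero)
  then have zb: "z j = 2 * (z j div 2)" for j using assms(1) by (metis add_0_right mult_div_mod_eq)
  define b where "b j = z j div 2" for j
  have zb: "z j = 2 * b j" for j using zb by (simp add: b_def)
  have "even (\<Sum>j\<in>UNIV. b j)" using assms(2) by (simp add: zb flip: sum_distrib_left) presburger
  moreover have "(\<Sum>j\<in>UNIV. b j * b j) = 7"
  proof -
    have "(\<Sum>j\<in>UNIV. z j * z j) = 4 * (\<Sum>j\<in>UNIV. b j * b j)"
      by (simp add: zb sum_distrib_left algebra_simps)
    then show ?thesis using assms(3) by simp
  qed
  moreover have "even ((\<Sum>j\<in>UNIV. b j * b j) - (\<Sum>j\<in>UNIV. b j))"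
    unfolding sum_subtractf[symmetric] by (intro dvd_sum) simp
  ultimately show False by simp
qed

section \<open>From an isometry to a frame and a monomial equivalence\<close>

lemma frame_columns:
  fixes C :: "(7 ^ 20) set"
  assumes lin: "linear_code C" and iso: "lattice_iso (constructionA 7 C) (D_plus_lattice :: (real ^ 20) set)"
  obtains z :: "20 \<Rightarrow> 20 \<Rightarrow> int" where "\<And>i j. odd (z i j)"
    "\<And>i k. (\<Sum>j\<in>UNIV. z i j * z k j) = (if i = k then 28 else 0)"
    "\<And>i k. (\<Sum>j\<in>UNIV. z j i * z j k) = (if i = k then 28 else 0)"
    "\<And>j. (\<chi> i. of_int (z i j)) \<in> C"
proof -
  obtain A :: "real ^ 20 ^ 20" where A: "orthogonal_matrix A"
    and D: "D_plus_lattice = (\<lambda>x. x v* A) ` constructionA 7 C"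
    using iso unfolding lattice_iso_def by blast
  have AA: "A ** transpose A = mat 1" "transpose A ** A = mat 1"
    using A by (simp_all add: orthogonal_matrix_def)
  have rows: "(\<Sum>j\<in>UNIV. A $ i $ j * A $ k $ j) = (if i = k then 1 else 0)" for i k
    using AA(1) by (simp add: vec_eq_iff matrix_matrix_mult_def transpose_def mat_def)
  have cols: "(\<Sum>j\<in>UNIV. A $ j $ i * A $ j $ k) = (if i = k then 1 else 0)" for i k
    using AA(2) by (simp add: vec_eq_iff matrix_matrix_mult_def transpose_def mat_def)
  have "\<exists>z :: 20 \<Rightarrow> int. (\<exists>e. \<forall>j. z j mod 2 = e) \<and> 4 dvd (\<Sum>j\<in>UNIV. z j) \<and>
      (\<forall>j. 2 * sqrt 7 * A $ i $ j = of_int (z j))" for i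
  proof -
    define v :: "real ^ 20" where "v = (\<chi> k. if k = i then sqrt 7 else 0)"
    have "(\<chi> k. (of_int (if k = i then 7 else 0) :: 7)) = 0" by (simp add: vec_eq_iff)
    then have "(\<chi> k. (of_int (if k = i then 7 else 0) :: 7)) \<in> C" using lin by (simp add: linear_code_def)
    moreover have "v $ k = sqrt 7 / 7 * of_int (if k = i then 7 else 0)" for k by (simp add: v_def)
    ultimately have "v \<in> constructionA 7 C"
      unfolding constructionA_7_iff by (intro exI[of _ "\<lambda>k. if k = i then 7 else 0"]) simp
    then have "v v* A \<in> D_plus_lattice" unfolding D by (rule imageI)
    then obtain z :: "20 \<Rightarrow> int" where z: "\<exists>e. \<forall>j. z j mod 2 = e" "4 dvd (\<Sum>j\<in>UNIV. z j)"
      "\<forall>j. (v v* A) $ j = of_int (z j) / 2"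
      unfolding D_plus_lattice_iff by blast
    have "(v v* A) $ j = sqrt 7 * A $ i $ j" for j
      by (simp add: vector_matrix_mult_def v_def if_distrib[of "\<lambda>x. x * _"] if_distrib[of "(*) _"] cong: if_cong)
    with z show ?thesis by (intro exI[of _ z]) (simp add: field_simps)
  qed
  then obtain z :: "20 \<Rightarrow> 20 \<Rightarrow> int" where z: "\<And>i. \<exists>e. \<forall>j. z i j mod 2 = e"
    "\<And>i. 4 dvd (\<Sum>j\<in>UNIV. z i j)" "\<And>i j. 2 * sqrt 7 * A $ i $ j = of_int (z i j)"
    by metis
  have zz: "of_int (z i j * z k l) = 28 * (A $ i $ j * A $ k $ l)" for i j k l
  proof -
    have "of_int (z i j * z k l) = (2 * sqrt 7 * A $ i $ j) * (2 * sqrt 7 * A $ k $ l)"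
      by (simp add: z(3))
    also have "\<dots> = 4 * (sqrt 7 * sqrt 7) * (A $ i $ j * A $ k $ l)" by (simp only: ac_simps)
    finally show ?thesis by simp
  qed
  have r: "(\<Sum>j\<in>UNIV. z i j * z k j) = (if i = k then 28 else 0)" for i k
  proof -
    have "real_of_int (\<Sum>j\<in>UNIV. z i j * z k j) = 28 * (\<Sum>j\<in>UNIV. A $ i $ j * A $ k $ j)"
      by (simp only: of_int_sum zz sum_distrib_left)
    then have "real_of_int (\<Sum>j\<in>UNIV. z i j * z k j) = real_of_int (if i = k then 28 else 0)"
      unfolding rows by simp
    then show ?thesis by (simp only: of_int_eq_iff)
  qed
  have c: "(\<Sum>j\<in>UNIV. z j i * z j k) = (if i = k then 28 else 0)" for i k
  proof -
    have "real_of_int (\<Sum>j\<in>UNIV. z j i * z j k) = 28 * (\<Sum>j\<in>UNIV. A $ j $ i * A $ j $ k)"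
      by (simp only: of_int_sum zz sum_distrib_left)
    then have "real_of_int (\<Sum>j\<in>UNIV. z j i * z j k) = real_of_int (if i = k then 28 else 0)"
      unfolding cols by simp
    then show ?thesis by (simp only: of_int_eq_iff)
  qed
  have o: "odd (z i j)" for i j
  proof -
    obtain e where "\<forall>j. z i j mod 2 = e" using z(1) by blast
    then show ?thesis using z(2) r[of i i] by (intro D_plus_norm_7_odd) simp_all
  qed
  have m: "(\<chi> i. of_int (z i j)) \<in> C" for j
  proof -
    \<comment> \<open>Doubled, this is 4 e_j: all entries even, sum 4. Its preimage under the
      isometry is column j of z times sqrt 7 / 7.\<close>
    define y :: "real ^ 20" where "y = (\<chi> k. if k = j then 2 else 0)"
    have "y \<in> D_plus_lattice"
      unfolding D_plus_lattice_iff
      by (intro exI[of _ "\<lambda>k. if k = j then 4 else 0"]) (simp add: y_def)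
    then obtain v where v: "v \<in> constructionA 7 C" "y = v v* A" unfolding D by blast
    then obtain x :: "20 \<Rightarrow> int" where x: "(\<chi> i. of_int (x i)) \<in> C" "\<forall>i. v $ i = sqrt 7 / 7 * of_int (x i)"
      unfolding constructionA_7_iff by blast
    have "v = y v* transpose A" by (simp only: v(2) vector_matrix_mul_assoc AA vector_matrix_mul_rid)
    then have "v $ i = 2 * A $ i $ j" for i
      by (simp add: matrix_vector_mult_def y_def if_distrib[of "(*) _"] cong: if_cong)
    then have xA: "sqrt 7 / 7 * of_int (x i) = 2 * A $ i $ j" for i by (simp only: spec[OF x(2)])
    have "of_int (x i) = real_of_int (z i j)" for i
    proof -
      have "real_of_int (x i) = sqrt 7 * (sqrt 7 / 7 * of_int (x i))" by (simp add: field_simps)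
      also have "\<dots> = 2 * sqrt 7 * A $ i $ j" unfolding xA by simp
      finally show ?thesis by (simp only: z(3))
    qed
    then have "x i = z i j" for i by (simp only: of_int_eq_iff)
    then have "x = (\<lambda>i. z i j)" by (rule ext)
    then show ?thesis using x(1) by simp
  qed
  show thesis using o r c m by (rule that)
qed

text \<open>If two rows of the frame violated skewness, their sum or difference would vanish on 12 of the
  remaining 18 coordinates.\<close>
lemma frame_skew:
  fixes R :: "20 \<Rightarrow> 20 \<Rightarrow> int" and C :: "(7 ^ 20) set"
  assumes diag: "\<And>v. R v v = 3" and entry: "\<And>v w. v \<noteq> w \<Longrightarrow> R v w = 1 \<or> R v w = - 1"
    and orth: "\<And>v w. v \<noteq> w \<Longrightarrow> (\<Sum>u\<in>UNIV. R v u * R w u) = 0"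
    and lin: "linear_code C" and mem: "\<And>v. (\<chi> w. of_int (R v w)) \<in> C"
    and mw: "\<And>c. c \<in> C \<Longrightarrow> c \<noteq> 0 \<Longrightarrow> 9 \<le> hamming_weight c"
    and "v \<noteq> w"
  shows "R v w = - R w v"
proof (rule ccontr)
  assume "R v w \<noteq> - R w v"
  moreover have vw: "R v w = 1 \<or> R v w = - 1" by (rule entry) fact
  moreover have "R w v = 1 \<or> R w v = - 1" by (rule entry) (use \<open>v \<noteq> w\<close> in simp)
  ultimately have eq: "R w v = R v w" by auto
  define a where "a = R v w"
  have aa: "a * a = 1" using vw by (auto simp: a_def)
  define S T where "S = UNIV - {v, w}" and "T = {u \<in> S. R v u + a * R w u = 0}"
  have S: "card S = 18" using \<open>v \<noteq> w\<close> by (simp add: S_def card_Diff_subset)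
  have cases: "a * (R v u * R w u) = (if u \<in> T then - 1 else 1)" if "u \<in> S" for u
  proof -
    have "v \<noteq> u" "w \<noteq> u" using that by (auto simp: S_def)
    then have "R v u = 1 \<or> R v u = - 1" "R w u = 1 \<or> R w u = - 1"
      by (blast dest: entry)+
    moreover have "a = 1 \<or> a = - 1" using vw by (simp add: a_def)
    ultimately show ?thesis using that by (auto simp: T_def)
  qed
  \<comment> \<open>Coordinates v and w contribute 3 a each, so the other 18 terms, multiplied by a,
    sum to -6: six are 1 and twelve are -1, and the latter are the zeros of row v plus a times row
    w.\<close>
  have "(\<Sum>u\<in>UNIV. R v u * R w u) = (\<Sum>u\<in>S. R v u * R w u) + (\<Sum>u\<in>{v, w}. R v u * R w u)"
    unfolding S_def by (rule sum.subset_diff) simp_all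
  also have "(\<Sum>u\<in>{v, w}. R v u * R w u) = 6 * a"
    using \<open>v \<noteq> w\<close> eq by (simp add: diag a_def)
  finally have "(\<Sum>u\<in>S. R v u * R w u) = - 6 * a" using orth[OF \<open>v \<noteq> w\<close>] by simp
  then have "(\<Sum>u\<in>S. a * (R v u * R w u)) = a * (- 6 * a)"
    by (simp only: sum_distrib_left[symmetric])
  also have "\<dots> = - 6" using aa by simp
  finally have "(\<Sum>u\<in>S. a * (R v u * R w u)) = - 6" .
  moreover have "(\<Sum>u\<in>S. a * (R v u * R w u)) = (\<Sum>u\<in>S. if u \<in> T then - 1 else 1)"
    using cases by (intro sum.cong) simp_all
  moreover have "(\<Sum>u\<in>S. if u \<in> T then - 1 else 1 :: int) = int (card (S - T)) - int (card T)"
  proof -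
    have "S \<inter> {u. u \<in> T} = T" "S \<inter> - {u. u \<in> T} = S - T" by (auto simp: T_def)
    then show ?thesis by (simp add: sum.If_cases)
  qed
  moreover have "card (S - T) = card S - card T" by (intro card_Diff_subset) (auto simp: T_def)
  moreover have "card T \<le> card S" by (intro card_mono) (auto simp: T_def)
  ultimately have T: "card T = 12" using S by linarith
  define c :: "7 ^ 20" where "c = (\<chi> u. of_int (R v u)) + of_int a *s (\<chi> u. of_int (R w u))"
  have cn: "c $ u = of_int (R v u + a * R w u)" for u by (simp add: c_def)
  have "c \<in> C" unfolding c_def using lin mem unfolding linear_code_def by blast
  \<comment> \<open>Coordinate v equals 3 + a a = 4, a unit modulo 7.\<close>
  moreover have "c \<noteq> 0"
  proof
    assume "c = 0"
    then have "of_int (R v v + a * R w v) = (0 :: 7)" using cn[of v] by simp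
    moreover have "R v v + a * R w v = 4" using aa eq by (simp add: diag a_def)
    ultimately show False by simp
  qed
  ultimately have "9 \<le> hamming_weight c" by (rule mw)
  also have "hamming_weight c \<le> card (UNIV - T)"
  proof -
    have "c $ u = 0" if "u \<in> T" for u unfolding cn using that by (simp only: T_def mem_Collect_eq of_int_0)
    then show ?thesis unfolding hamming_weight_def by (intro card_mono) auto
  qed
  also have "\<dots> = 8" using T by (simp add: card_Diff_subset)
  finally show False by simp
qed

lemma code_equiv_QR20:
  fixes C :: "(7 ^ 20) set"
  assumes lin: "linear_code C" and card: "card C = 7 ^ 10"
    and mw: "\<And>c. c \<in> C \<Longrightarrow> c \<noteq> 0 \<Longrightarrow> 9 \<le> hamming_weight c"
    and iso: "lattice_iso (constructionA 7 C) (D_plus_lattice :: (real ^ 20) set)"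
  shows "code_equiv C QR20"
proof -
  obtain z :: "20 \<Rightarrow> 20 \<Rightarrow> int" where odd: "\<And>i j. odd (z i j)"
    and rows: "\<And>i k. (\<Sum>j\<in>UNIV. z i j * z k j) = (if i = k then 28 else 0)"
    and cols: "\<And>i k. (\<Sum>j\<in>UNIV. z j i * z j k) = (if i = k then 28 else 0)"
    and mem: "\<And>j. (\<chi> i. of_int (z i j)) \<in> C"
    by (rule frame_columns[OF lin iso]) blast
  have "\<exists>j. \<bar>z i j\<bar> = 3" for i
    using odd_norm_28[of "z i"] odd rows[of i i] by auto
  then obtain \<rho> where \<rho>: "\<And>i. \<bar>z i (\<rho> i)\<bar> = 3" by metis
  \<comment> \<open>Columns have norm 28 as well, so column \<open>\<rho> v\<close> has a single
    entry of absolute value 3, the one in row v. This also makes \<open>\<rho>\<close>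
    injective.\<close>
  have other: "\<bar>z w (\<rho> v)\<bar> = 1" if "w \<noteq> v" for v w
  proof -
    have "\<exists>i. \<bar>z i (\<rho> v)\<bar> = 3 \<and> (\<forall>j. j \<noteq> i \<longrightarrow> \<bar>z j (\<rho> v)\<bar> = 1)"
      using odd cols[of "\<rho> v" "\<rho> v"] by (intro odd_norm_28) simp_all
    then obtain i where i: "\<forall>j. j \<noteq> i \<longrightarrow> \<bar>z j (\<rho> v)\<bar> = 1" by blast
    then have "i = v" using \<rho>[of v] by force
    then show ?thesis using i that by blast
  qed
  have inj: "\<rho> v \<noteq> \<rho> w" if "v \<noteq> w" for v w
    using other[of w v] \<rho>[of w] that by force
  define t where "t v = z v (\<rho> v) div 3" for v
  have t: "t v = 1 \<and> z v (\<rho> v) = 3 \<or> t v = - 1 \<and> z v (\<rho> v) = - 3" for v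
    using \<rho>[of v] by (auto simp: t_def abs_if split: if_splits)
  \<comment> \<open>Row v of R is column \<open>\<rho> v\<close> of z, a codeword, with its sign
    chosen so that the diagonal entry is +3.\<close>
  define R where "R v w = t v * z w (\<rho> v)" for v w
  have diag: "R v v = 3" for v using t[of v] by (auto simp: R_def)
  have entry: "R v w = 1 \<or> R v w = - 1" if "v \<noteq> w" for v w
    using t[of v] other[of w v] that by (auto simp: R_def abs_if split: if_splits)
  have orth: "(\<Sum>u\<in>UNIV. R v u * R w u) = 0" if "v \<noteq> w" for v w
  proof -
    have "(\<Sum>u\<in>UNIV. R v u * R w u) = t v * t w * (\<Sum>u\<in>UNIV. z u (\<rho> v) * z u (\<rho> w))"
      by (simp add: R_def sum_distrib_left ac_simps)
    then show ?thesis using cols[of "\<rho> v" "\<rho> w"] inj[OF that] by simp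
  qed
  have memR: "(\<chi> w. of_int (R v w)) \<in> C" for v
  proof -
    have "(\<chi> w. of_int (R v w)) = of_int (t v) *s (\<chi> w. (of_int (z w (\<rho> v)) :: 7))"
      by (simp add: vec_eq_iff R_def)
    then show ?thesis using lin mem by (simp add: linear_code_def)
  qed
  have skew: "R v w = - R w v" if "v \<noteq> w" for v w
    by (rule frame_skew[OF diag entry orth lin memR mw that])
  define v0 :: 20 where "v0 = 0"
  \<comment> \<open>Conjugation by these signs makes row \<open>v0\<close> positive; at
    \<open>v0\<close> itself the diagonal 3 is replaced by 1 to obtain a sign.\<close>
  define s where "s w = (if w = v0 then 1 else R v0 w)" for w
  have s: "s w = 1 \<or> s w = - 1" for w using entry[of v0 w] by (auto simp: s_def)
  have ss: "s w * s w = 1" for w using s[of w] by auto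
  have ss7: "of_int (s w) * (of_int (s w) * x) = (x :: 7)" for w x
    using ss[of w] by (metis mult.assoc mult_1 of_int_1 of_int_mult)
  define sg :: "7 ^ 20 \<Rightarrow> 7 ^ 20" where "sg c = (\<chi> w. of_int (s w) * c $ w)" for c
  have sg2: "sg (sg c) = c" for c by (simp add: sg_def vec_eq_iff ss7)
  have sg_add: "sg (x + y) = sg x + sg y" for x y by (simp add: sg_def vec_eq_iff distrib_left)
  have sg_scale: "sg (a *s x) = a *s sg x" for a x by (simp add: sg_def vec_eq_iff mult.left_commute)
  have sg0: "sg 0 = 0" by (simp add: sg_def vec_eq_iff)
  have sgw: "hamming_weight (sg c) = hamming_weight c" for c
  proof -
    have "of_int (s w) * x = 0 \<longleftrightarrow> x = 0" for w and x :: 7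
      using ss7[of w x] by auto
    then show ?thesis by (simp add: hamming_weight_def sg_def)
  qed
  \<comment> \<open>The column signs act on the code through \<open>sg\<close>; the row sign is a
    scalar and is absorbed by linearity.\<close>
  define C' where "C' = sg ` C"
  have inC': "c \<in> C' \<longleftrightarrow> sg c \<in> C" for c unfolding C'_def by (metis image_iff sg2)
  have "inj_on sg C" by (metis inj_onI sg2)
  then have card': "card C' = 7 ^ 10" unfolding C'_def using card by (simp add: card_image)
  interpret normalised_frame "\<lambda>v w. s v * s w * R v w" C' v0
  proof
    show "s v * s v * R v v = 3" for v by (simp add: diag ss)
    show "s v * s w * R v w = - (s w * s v * R w v)" if "v \<noteq> w" for v w
      using skew[OF that] by simp
    show "s v * s w * R v w = 1 \<or> s v * s w * R v w = - 1" if "v \<noteq> w" for v w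
      using s[of v] s[of w] entry[OF that] by auto
    show "(\<Sum>u\<in>UNIV. s v * s u * R v u * (s w * s u * R w u)) = 0" if "v \<noteq> w" for v w
    proof -
      have st: "s v * s u * R v u * (s w * s u * R w u) = s v * s w * (R v u * R w u)" for u
        using s[of u] by auto
      have "(\<Sum>u\<in>UNIV. s v * s u * R v u * (s w * s u * R w u)) =
          s v * s w * (\<Sum>u\<in>UNIV. R v u * R w u)"
        by (simp only: st sum_distrib_left)
      then show ?thesis using orth[OF that] by simp
    qed
    show "s v0 * s w * R v0 w = 1" if "w \<noteq> v0" for w
      using that ss[of w] by (simp add: s_def)
    show "linear_code C'"
      using lin by (simp add: linear_code_def inC' sg_add sg_scale sg0)
    show "(\<chi> w. of_int (s v * s w * R v w)) \<in> C'" for v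
    proof -
      have "sg (\<chi> w. of_int (s v * s w * R v w)) = of_int (s v) *s (\<chi> w. of_int (R v w))"
        by (simp add: sg_def vec_eq_iff) (metis mult.assoc mult.left_commute ss7)
      then show ?thesis using lin memR by (simp add: inC' linear_code_def)
    qed
    show "9 \<le> hamming_weight c" if "c \<in> C'" "c \<noteq> 0" for c
    proof -
      have "sg c \<noteq> 0" using that(2) sg0 sg2 by metis
      then show ?thesis using mw[of "sg c"] that(1) by (simp add: inC' sgw)
    qed
  qed
  obtain \<tau> where \<tau>: "\<tau> permutes UNIV" "QR20 = {y. (\<chi> w. y $ \<tau> w) \<in> C'}"
    using permuted_QR20[OF card'] by blast
  \<comment> \<open>The sign change \<open>sg\<close> followed by the coordinate permutation found
    by the search, as one monomial matrix.\<close>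
  define M :: "7 ^ 20 ^ 20" where "M = (\<chi> i j. if j = \<tau> i then of_int (s i) else 0)"
  have "\<forall>i. (of_int (s i) :: 7) = 1 \<or> of_int (s i) = (- 1 :: 7)" using s by (metis of_int_1 of_int_minus)
  then have M: "signed_perm_matrix M"
    unfolding signed_perm_matrix_def M_def using \<tau>(1)
    by (intro exI[of _ \<tau>] exI[of _ "\<lambda>i. of_int (s i)"]) simp
  have mult: "(c v* M) $ \<tau> w = of_int (s w) * c $ w" for c w
  proof -
    have "\<tau> w = \<tau> i \<longleftrightarrow> i = w" for i using permutes_inj[OF \<tau>(1)] by (auto dest: injD)
    then show ?thesis
      by (simp add: vector_matrix_mult_def M_def if_distrib[of "(*) _"] mult.commute cong: if_cong)
  qed
  have "QR20 = (\<lambda>c. c v* M) ` C"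
  proof (intro equalityI subsetI)
    fix y assume "y \<in> QR20"
    define c where "c = sg (\<chi> w. y $ \<tau> w)"
    have "c \<in> C" using \<open>y \<in> QR20\<close> unfolding \<tau>(2) c_def by (simp add: inC')
    moreover have "(c v* M) $ \<tau> w = y $ \<tau> w" for w
      by (simp add: mult c_def sg_def ss7)
    then have "(c v* M) $ j = y $ j" for j using permutes_surj[OF \<tau>(1)] by (metis surjD)
    then have "y = c v* M" by (simp add: vec_eq_iff)
    ultimately show "y \<in> (\<lambda>c. c v* M) ` C" by blast
  next
    fix y assume "y \<in> (\<lambda>c. c v* M) ` C"
    then obtain c where c: "c \<in> C" "y = c v* M" by blast
    have "(\<chi> w. y $ \<tau> w) = sg c" by (simp add: vec_eq_iff c(2) mult sg_def)
    then show "y \<in> QR20" using c(1) by (simp add: \<tau>(2) inC' sg2)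
  qed
  with M show ?thesis unfolding code_equiv_def by blast
qed

theorem theorem1:
  shows "self_dual QR20 \<and> is_code QR20 10 9 \<and>
         lattice_iso (constructionA 7 QR20) (D_plus_lattice :: (real ^ 20) set) \<and>
         (\<forall>C :: (7 ^ 20) set.
            self_dual C \<and> is_code C 10 9 \<and>
            lattice_iso (constructionA 7 C) (D_plus_lattice :: (real ^ 20) set)
            \<longrightarrow> code_equiv C QR20)"
proof (intro conjI allI impI)
  fix C :: "(7 ^ 20) set"
  assume C: "self_dual C \<and> is_code C 10 9 \<and>
    lattice_iso (constructionA 7 C) (D_plus_lattice :: (real ^ 20) set)"
  then have "linear_code C" "card C = 7 ^ 10" "min_distance C = 9"
    by (simp_all add: is_code_def)
  moreover from this have "9 \<le> hamming_weight c" if "c \<in> C" "c \<noteq> 0" for c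
    using min_distance_le[OF that] by simp
  ultimately show "code_equiv C QR20" using C by (intro code_equiv_QR20) auto
qed (fact self_dual_QR20 is_code_QR20 lattice_iso_QR20)+

end
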